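(* Consider the exact block systems described in the context, with $K_*$ defined by $\sigma(P,\mathcal S)=K_*q^{(d-1)/2}\sqrt{|P||\mathcal S|}$. (1) Fix $d\ge4$ and $C_1\ge1$. For all sufficiently large odd prime powers $q$, every nondegenerate quadratic space $(\mathbb F_q^d,Q)$ admits such a block system, i.e. a point set $P$ and a family $\mathcal S$ of distinct spheres of one fixed nonzero radius, such that $$\frac{4q}{K_*^2}\le|\mathcal S|\le C_1K_*q^{(d-1)/2},$$ while $\max_H\frac{|P\cap H|}{|P|}\to0$ as $q\to\infty$ (maximum over affine hyperplanes $H$), and the number $t$ of exact centered blocks tends to infinity. (2) Let $d=3$, fix an integer $t\ge3$, and assume $C_1>t/\sqrt2$. For all sufficiently large odd prime powers $q$, every nondegenerate ternary quadratic space over $\mathbb F_q$ admits such a block system with exactly $t$ blocks, one fixed nonzero radius, and $$\frac{4q}{K_*^2}\le|\mathcal S|=tq\le C_1K_*q,\qquad K_*=(1-q^{-1})\sqrt2.$$ Each diagonal block carries exactly $1/t$ of the total surplus, $\sigma(A_z,\mathcal S_z)=\frac1t\sigma(P,\mathcal S)$, and all cross-block centered discrepancies $\sigma(A_b,\mathcal S_z)$, $b\ne z$, vanish. Consequently, for $d\ge4$, no lower bound $|P\cap H|\ge cK_*^{-C}|P|$ for some affine hyperplane $H$, with fixed $c>0$ and $C<\infty$, can follow from fixed-scale surplus and the moderate window, even for one nonzero radius: for any fixed $c>0$, $C<\infty$, the systems in (1) satisfy $|P\cap H|<cK_*^{-C}|P|$ for every affine hyperplane $H$ once $q$ is sufficiently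 large. For every fixed $\delta>0$, the examples in (1) also satisfy $|P\cap L|\le\delta|P|$ for every proper affine flat $L\subsetneq\mathbb F_q^d$ (hence for every affine totally singular flat) once $q$ is sufficiently large.
   Context: Put $\langle x,y\rangle_Q=\frac{Q(x+y)-Q(x)-Q(y)}2$, $v^{\perp_Q}=\{x:\langle x,v\rangle_Q=0\}$, and $S_Q(c,r)=\{x\in\mathbb F_q^d:Q(x-c)=r\}$; spheres are parametrized by pairs $(c,r)$, distinct spheres meaning distinct pairs. $\sigma(A,\mathcal T)=|\{(p,S)\in A\times\mathcal T:p\in S\}|-|A||\mathcal T|/q$. Block systems ($d\ge3$, $q$ odd, $Q$ nondegenerate on $\mathbb F_q^d$). Choose $v\ne0$ with $Q(v)=0$ and $w$ with $\langle w,v\rangle_Q=1$. Choose $R\in\mathbb F_q^\times$ represented by $Q$ on $v^{\perp_Q}$ and put $X_R=\{y\in v^{\perp_Q}:Q(y)=R\}$. Let $Z\subseteq\mathbb F_q$ be nonempty, $t=|Z|$ (the number of blocks). For $z\in Z$ put $c_z=zw$, $A_z=c_z+X_R$, $\mathcal S_z=\{S_Q(c_z+uv,R):u\in\mathbb F_q\}$, and $P=\bigsqcup_{z\in Z}A_z$, $\mathcal S=\bigsqcup_{z\in Z}\mathcal S_z$; thus all spheres of $\mathcal S$ have the same radius $R\ne0$. These are exact centered blocks: $\sigma(A_b,\mathcal S_z)=0$ for $b\ne z$ and $\sigma(P,\mathcal S)=\sum_z\sigma(A_z,\mathcal S_z)$. An affine flat is totally singular if $Q$ vanishes on its direction space.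 The "moderate window" with constant $C_1$ and parameter $K$ is $\frac{4|P|}{K^2q^{d-1}}\le|\mathcal S|\le C_1Kq^{(d-1)/2}$; "fixed-scale surplus" is $\sigma(P,\mathcal S)\ge Kq^{(d-1)/2}\sqrt{|P||\mathcal S|}$. *)

theory Defs
  imports
    Complex_Main
    "HOL-Algebra.Coset"
    "HOL-Algebra.Module"
    "HOL-Library.Disjoint_Sets"
    "HOL-Library.Infinite_Typeclass"
begin

text \<open>
  Thresholds in \<open>q\<close> have to be chosen before the field of order \<open>q\<close>, so fields are
  HOL-Algebra structures \<open>R\<close> on a carrier type \<open>'a\<close> rather than types. The power \<open>R^d\<close> is
  realised by extensional functions on \<open>{..<d}\<close>, and a form \<open>Q\<close> only matters on the carrier
  of \<open>R^d\<close>.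
\<close>

type_synonym 'a qspace = "'a ring \<times> ((nat \<Rightarrow> 'a) \<Rightarrow> 'a)"

text \<open>A module record inherits the fields \<open>mult\<close> and \<open>one\<close> from rings; modules do not use them.\<close>

definition coord_space :: "('a, 'm) ring_scheme \<Rightarrow> nat \<Rightarrow> ('a, nat \<Rightarrow> 'a) module" where
  "coord_space R d =
    \<lparr> carrier = {..<d} \<rightarrow>\<^sub>E carrier R,
      mult = undefined, one = undefined,
      zero = (\<lambda>i\<in>{..<d}. \<zero>\<^bsub>R\<^esub>),
      add = (\<lambda>x y. \<lambda>i\<in>{..<d}. x i \<oplus>\<^bsub>R\<^esub> y i),
      smult = (\<lambda>a x. \<lambda>i\<in>{..<d}. a \<otimes>\<^bsub>R\<^esub> x i) \<rparr>"

lemma module_coord_space: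
  assumes "cring R"
  shows "Module.module R (coord_space R d)"
proof -
  interpret R: cring R by fact
  have "abelian_group (coord_space R d)"
  proof (rule abelian_groupI)
    fix x assume "x \<in> carrier (coord_space R d)"
    then show "\<zero>\<^bsub>coord_space R d\<^esub> \<oplus>\<^bsub>coord_space R d\<^esub> x = x"
      by (auto simp: coord_space_def PiE_iff extensional_def fun_eq_iff)
  next
    fix x assume "x \<in> carrier (coord_space R d)"
    then show "\<exists>y\<in>carrier (coord_space R d).
        y \<oplus>\<^bsub>coord_space R d\<^esub> x = \<zero>\<^bsub>coord_space R d\<^esub>"
      by (intro bexI[where x = "\<lambda>i\<in>{..<d}. \<ominus>\<^bsub>R\<^esub> x i"])
         (auto simp: coord_space_def PiE_iff fun_eq_iff restrict_def extensional_def R.l_neg)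
  qed (auto simp: coord_space_def PiE_iff fun_eq_iff restrict_def extensional_def R.a_ac)
  then show ?thesis
    by (rule Module.moduleI[OF assms])
       (auto simp: coord_space_def PiE_iff fun_eq_iff restrict_def extensional_def
          R.l_distr R.r_distr R.m_assoc)
qed


section \<open>Quadratic spaces of odd characteristic\<close>

text \<open>In odd characteristic, half the polarisation of \<open>Q\<close>.\<close>

definition qinner ::
    "('a, 'm) ring_scheme \<Rightarrow> ('a, 'b, 'n) module_scheme \<Rightarrow> ('b \<Rightarrow> 'a) \<Rightarrow> 'b \<Rightarrow> 'b \<Rightarrow> 'a" where
  "qinner R M Q x y =
    (Q (x \<oplus>\<^bsub>M\<^esub> y) \<ominus>\<^bsub>R\<^esub> Q x \<ominus>\<^bsub>R\<^esub> Q y) \<otimes>\<^bsub>R\<^esub> inv\<^bsub>R\<^esub> (\<one>\<^bsub>R\<^esub> \<oplus>\<^bsub>R\<^esub> \<one>\<^bsub>R\<^esub>)"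

text \<open>The polarisation is symmetric, so linearity in the first argument gives bilinearity.\<close>

definition quadratic_form ::
    "('a, 'm) ring_scheme \<Rightarrow> ('a, 'b, 'n) module_scheme \<Rightarrow> ('b \<Rightarrow> 'a) \<Rightarrow> bool" where
  "quadratic_form R M Q \<longleftrightarrow>
    Q \<in> carrier M \<rightarrow> carrier R \<and>
    (\<forall>a\<in>carrier R. \<forall>x\<in>carrier M. Q (a \<odot>\<^bsub>M\<^esub> x) = a \<otimes>\<^bsub>R\<^esub> a \<otimes>\<^bsub>R\<^esub> Q x) \<and>
    (\<forall>x\<in>carrier M. \<forall>y\<in>carrier M. \<forall>z\<in>carrier M.
      qinner R M Q (x \<oplus>\<^bsub>M\<^esub> y) z = qinner R M Q x z \<oplus>\<^bsub>R\<^esub> qinner R M Q y z) \<and>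
    (\<forall>a\<in>carrier R. \<forall>x\<in>carrier M. \<forall>y\<in>carrier M.
      qinner R M Q (a \<odot>\<^bsub>M\<^esub> x) y = a \<otimes>\<^bsub>R\<^esub> qinner R M Q x y)"

definition nondegenerate ::
    "('a, 'm) ring_scheme \<Rightarrow> ('a, 'b, 'n) module_scheme \<Rightarrow> ('b \<Rightarrow> 'a) \<Rightarrow> bool" where
  "nondegenerate R M Q \<longleftrightarrow>
    (\<forall>x\<in>carrier M. (\<forall>y\<in>carrier M. qinner R M Q x y = \<zero>\<^bsub>R\<^esub>) \<longrightarrow> x = \<zero>\<^bsub>M\<^esub>)"

definition nondeg_spaces :: "nat \<Rightarrow> 'a qspace set" where
  "nondeg_spaces d = {(R, Q). field R \<and> finite (carrier R) \<and> odd (order R) \<and>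
    quadratic_form R (coord_space R d) Q \<and> nondegenerate R (coord_space R d) Q}"

text \<open>
  The limit \<open>q \<rightarrow> \<infinity>\<close>, uniformly over all nondegenerate spaces over a field of order \<open>q\<close>: a
  property holds eventually iff there is a \<open>q0\<close> such that it holds for all \<open>(R, Q)\<close> in
  \<open>nondeg_spaces d\<close> with \<open>order R \<ge> q0\<close>. When \<open>'a\<close> is infinite, every finite field has an
  isomorphic copy with carrier in \<open>'a\<close>.
\<close>

definition large_spaces :: "nat \<Rightarrow> 'a qspace filter" where
  "large_spaces d =
    inf (filtercomap (\<lambda>(R, Q). order R) at_top) (principal (nondeg_spaces d))"

lemma eventually_large_spaces:
  "eventually P (large_spaces d) \<longleftrightarrow>
    (\<exists>q0. \<forall>(R, Q)\<in>nondeg_spaces d. q0 \<le> order R \<longrightarrow> P (R, Q))"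
  unfolding large_spaces_def eventually_inf_principal eventually_filtercomap
    eventually_at_top_linorder
proof
  assume "\<exists>Pa. (\<exists>N. \<forall>n\<ge>N. Pa n) \<and>
    (\<forall>x. Pa (case x of (R, Q) \<Rightarrow> order R) \<longrightarrow> x \<in> nondeg_spaces d \<longrightarrow> P x)"
  then show "\<exists>q0. \<forall>(R, Q)\<in>nondeg_spaces d. q0 \<le> order R \<longrightarrow> P (R, Q)"
    by fastforce
next
  assume "\<exists>q0. \<forall>(R, Q)\<in>nondeg_spaces d. q0 \<le> order R \<longrightarrow> P (R, Q)"
  then obtain q0 where "\<forall>(R, Q)\<in>nondeg_spaces d. q0 \<le> order R \<longrightarrow> P (R, Q)" ..
  then show "\<exists>Pa. (\<exists>N. \<forall>n\<ge>N. Pa n) \<and>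
    (\<forall>x. Pa (case x of (R, Q) \<Rightarrow> order R) \<longrightarrow> x \<in> nondeg_spaces d \<longrightarrow> P x)"
    by (intro exI[where x = "\<lambda>n. q0 \<le> n"]) auto
qed


section \<open>Affine flats\<close>

definition hyperplanes :: "('a, 'm) ring_scheme \<Rightarrow> nat \<Rightarrow> (nat \<Rightarrow> 'a) set set" where
  "hyperplanes R d =
    {{x \<in> carrier (coord_space R d). (\<Oplus>\<^bsub>R\<^esub>i\<in>{..<d}. a i \<otimes>\<^bsub>R\<^esub> x i) = b} | a b.
      a \<in> carrier (coord_space R d) \<and> a \<noteq> \<zero>\<^bsub>coord_space R d\<^esub> \<and> b \<in> carrier R}"

definition affine_flat ::
    "('a, 'm) ring_scheme \<Rightarrow> ('a, 'b, 'n) module_scheme \<Rightarrow> 'b set \<Rightarrow> bool" where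
  "affine_flat R M L \<longleftrightarrow>
    (\<exists>p\<in>carrier M. \<exists>U. submodule U R M \<and> L = (\<lambda>x. p \<oplus>\<^bsub>M\<^esub> x) ` U)"

definition totally_singular_flat ::
    "('a, 'm) ring_scheme \<Rightarrow> ('a, 'b, 'n) module_scheme \<Rightarrow> ('b \<Rightarrow> 'a) \<Rightarrow> 'b set \<Rightarrow> bool" where
  "totally_singular_flat R M Q L \<longleftrightarrow>
    (\<exists>p\<in>carrier M. \<exists>U. submodule U R M \<and> (\<forall>x\<in>U. Q x = \<zero>\<^bsub>R\<^esub>) \<and>
      L = (\<lambda>x. p \<oplus>\<^bsub>M\<^esub> x) ` U)"

definition max_hyperplane_share ::
    "('a, 'm) ring_scheme \<Rightarrow> nat \<Rightarrow> (nat \<Rightarrow> 'a) set \<Rightarrow> real" where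
  "max_hyperplane_share R d P = (MAX H\<in>hyperplanes R d. real (card (P \<inter> H)) / real (card P))"


section \<open>Spheres and discrepancy\<close>

text \<open>
  A family of spheres is a set of pairs (centre, radius); two different pairs count as different
  spheres even if their point sets coincide.
\<close>

definition qsphere ::
    "('a, 'b, 'n) module_scheme \<Rightarrow> ('b \<Rightarrow> 'a) \<Rightarrow> 'b \<times> 'a \<Rightarrow> 'b set" where
  "qsphere M Q = (\<lambda>(c, r). {x \<in> carrier M. Q (x \<ominus>\<^bsub>M\<^esub> c) = r})"

definition discrepancy ::
    "('a, 'm) ring_scheme \<Rightarrow> ('a, 'b, 'n) module_scheme \<Rightarrow> ('b \<Rightarrow> 'a) \<Rightarrow>
      'b set \<Rightarrow> ('b \<times> 'a) set \<Rightarrow> real" where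
  "discrepancy R M Q A T =
    real (card {(p, S) \<in> A \<times> T. p \<in> qsphere M Q S}) -
    real (card A) * real (card T) / real (order R)"

text \<open>The constant \<open>K\<close> with \<open>\<sigma>(P, T) = K q^((d - 1) / 2) sqrt (|P| |T|)\<close>, for \<open>P\<close>, \<open>T\<close> nonempty.\<close>

definition surplus_constant ::
    "'a ring \<Rightarrow> nat \<Rightarrow> ((nat \<Rightarrow> 'a) \<Rightarrow> 'a) \<Rightarrow>
      (nat \<Rightarrow> 'a) set \<Rightarrow> ((nat \<Rightarrow> 'a) \<times> 'a) set \<Rightarrow> real" where
  "surplus_constant R d Q P T =
    discrepancy R (coord_space R d) Q P T /
    (real (order R) powr ((real d - 1) / 2) * sqrt (real (card P) * real (card T)))"

definition fixed_scale_surplus ::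
    "'a ring \<Rightarrow> nat \<Rightarrow> ((nat \<Rightarrow> 'a) \<Rightarrow> 'a) \<Rightarrow> real \<Rightarrow>
      (nat \<Rightarrow> 'a) set \<Rightarrow> ((nat \<Rightarrow> 'a) \<times> 'a) set \<Rightarrow> bool" where
  "fixed_scale_surplus R d Q K P T \<longleftrightarrow>
    discrepancy R (coord_space R d) Q P T \<ge>
    K * real (order R) powr ((real d - 1) / 2) * sqrt (real (card P) * real (card T))"

definition moderate_window ::
    "'a ring \<Rightarrow> nat \<Rightarrow> real \<Rightarrow> real \<Rightarrow>
      (nat \<Rightarrow> 'a) set \<Rightarrow> ((nat \<Rightarrow> 'a) \<times> 'a) set \<Rightarrow> bool" where
  "moderate_window R d C1 K P T \<longleftrightarrow>
    4 * real (card P) / (K\<^sup>2 * real (order R) ^ (d - 1)) \<le> real (card T) \<and>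
    real (card T) \<le> C1 * K * real (order R) powr ((real d - 1) / 2)"


section \<open>Block systems\<close>

record ('a, 'b) block_data =
  iso_vec :: 'b     \<comment> \<open>\<open>v\<close>\<close>
  dual_vec :: 'b    \<comment> \<open>\<open>w\<close>\<close>
  rad :: 'a         \<comment> \<open>the common radius; \<open>R\<close> denotes the field\<close>
  idx :: "'a set"   \<comment> \<open>\<open>Z\<close>\<close>

definition perp ::
    "('a, 'm) ring_scheme \<Rightarrow> ('a, 'b, 'n) module_scheme \<Rightarrow> ('b \<Rightarrow> 'a) \<Rightarrow> 'b \<Rightarrow> 'b set" where
  "perp R M Q v = {x \<in> carrier M. qinner R M Q x v = \<zero>\<^bsub>R\<^esub>}"

definition base_section ::
    "('a, 'm) ring_scheme \<Rightarrow> ('a, 'b, 'n) module_scheme \<Rightarrow> ('b \<Rightarrow> 'a) \<Rightarrow>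
      ('a, 'b) block_data \<Rightarrow> 'b set" where
  "base_section R M Q B = {y \<in> perp R M Q (iso_vec B). Q y = rad B}"

definition block_system ::
    "('a, 'm) ring_scheme \<Rightarrow> ('a, 'b, 'n) module_scheme \<Rightarrow> ('b \<Rightarrow> 'a) \<Rightarrow>
      ('a, 'b) block_data \<Rightarrow> bool" where
  "block_system R M Q B \<longleftrightarrow>
    iso_vec B \<in> carrier M \<and> iso_vec B \<noteq> \<zero>\<^bsub>M\<^esub> \<and> Q (iso_vec B) = \<zero>\<^bsub>R\<^esub> \<and>
    dual_vec B \<in> carrier M \<and> qinner R M Q (dual_vec B) (iso_vec B) = \<one>\<^bsub>R\<^esub> \<and>
    rad B \<in> carrier R \<and> rad B \<noteq> \<zero>\<^bsub>R\<^esub> \<and> rad B \<in> Q ` perp R M Q (iso_vec B) \<and>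
    idx B \<subseteq> carrier R \<and> idx B \<noteq> {}"

definition point_block ::
    "('a, 'm) ring_scheme \<Rightarrow> ('a, 'b, 'n) module_scheme \<Rightarrow> ('b \<Rightarrow> 'a) \<Rightarrow>
      ('a, 'b) block_data \<Rightarrow> 'a \<Rightarrow> 'b set" where
  "point_block R M Q B z = (\<lambda>y. (z \<odot>\<^bsub>M\<^esub> dual_vec B) \<oplus>\<^bsub>M\<^esub> y) ` base_section R M Q B"

definition sphere_block ::
    "('a, 'm) ring_scheme \<Rightarrow> ('a, 'b, 'n) module_scheme \<Rightarrow>
      ('a, 'b) block_data \<Rightarrow> 'a \<Rightarrow> ('b \<times> 'a) set" where
  "sphere_block R M B z =
    (\<lambda>u. ((z \<odot>\<^bsub>M\<^esub> dual_vec B) \<oplus>\<^bsub>M\<^esub> (u \<odot>\<^bsub>M\<^esub> iso_vec B), rad B)) ` carrier R"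

definition block_points ::
    "('a, 'm) ring_scheme \<Rightarrow> ('a, 'b, 'n) module_scheme \<Rightarrow> ('b \<Rightarrow> 'a) \<Rightarrow>
      ('a, 'b) block_data \<Rightarrow> 'b set" where
  "block_points R M Q B = (\<Union>z\<in>idx B. point_block R M Q B z)"

definition block_spheres ::
    "('a, 'm) ring_scheme \<Rightarrow> ('a, 'b, 'n) module_scheme \<Rightarrow>
      ('a, 'b) block_data \<Rightarrow> ('b \<times> 'a) set" where
  "block_spheres R M B = (\<Union>z\<in>idx B. sphere_block R M B z)"

text \<open>
  These properties hold for every block system; they are not part of its definition, so that
  stating them has content.
\<close>

definition exact_centered_blocks ::
    "('a, 'm) ring_scheme \<Rightarrow> ('a, 'b, 'n) module_scheme \<Rightarrow> ('b \<Rightarrow> 'a) \<Rightarrow>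
      ('a, 'b) block_data \<Rightarrow> bool" where
  "exact_centered_blocks R M Q B \<longleftrightarrow>
    disjoint_family_on (point_block R M Q B) (idx B) \<and>
    disjoint_family_on (sphere_block R M B) (idx B) \<and>
    (\<forall>b\<in>idx B. \<forall>z\<in>idx B. b \<noteq> z \<longrightarrow>
      discrepancy R M Q (point_block R M Q B b) (sphere_block R M B z) = 0) \<and>
    discrepancy R M Q (block_points R M Q B) (block_spheres R M B) =
      (\<Sum>z\<in>idx B. discrepancy R M Q (point_block R M Q B z) (sphere_block R M B z))"

end

theory Submission
  imports Defs "HOL-Number_Theory.Residues" "HOL-Algebra.Weak_Morphisms"
begin

text \<open>
  If \<open>b \<noteq> z\<close>, then for \<open>p = b w + y\<close> with \<open>y \<in> X\<close> the equation \<open>Q (p - z w - u v) = rad\<close> is linear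
  in \<open>u\<close> with exactly one solution, while for \<open>b = z\<close> it holds for every \<open>u\<close>. Hence all
  cross-block discrepancies vanish, a diagonal block carries \<open>N (q - 1)\<close> with \<open>N = |X|\<close>, and
  \<open>K = sqrt N (q - 1) / q^(d/2)\<close>. The set \<open>X\<close> is a level set of \<open>Q\<close> in the hyperplane orthogonal
  to \<open>v\<close>, of size \<open>q^(d-1)\<close>; no exact point count on quadrics is needed. Lines in an
  anisotropic direction meet it in at most two points, so \<open>N \<le> 2 q^(d-2)\<close>, and averaging over the
  nonzero values gives a radius with \<open>N \<ge> q^(d-2) / 2\<close>. Thus \<open>K\<close> stays in \<open>[1/4, 2]\<close>. For
  \<open>d = 3\<close>, \<open>X\<close> is a pair of parallel lines, so \<open>N = 2 q\<close>.

  An affine hyperplane \<open>f = c\<close> with \<open>f = 0\<close> on the orthogonal space of \<open>v\<close> meets only one of the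
  \<open>t\<close> blocks. Otherwise it meets each block in at most \<open>2 q^(d-3)\<close> points, by lines again. Hence its
  share of the points is at most \<open>4/q + 1/t\<close>, and every proper flat lies in such a hyperplane.
\<close>

text \<open>The number \<open>t\<close> of blocks cancels from \<open>K\<close>, since the surplus,
  the points and the spheres each carry one factor \<open>t\<close>. So \<open>t\<close> is free,
  and only the window ties it to \<open>q\<close>. With \<open>K\<close> bounded below by
  \<open>1/4\<close>, the lower edge holds once \<open>t \<ge> 64\<close>. The upper edge leaves
  room for \<open>t\<close> to grow when \<open>d \<ge> 4\<close>. For \<open>d = 3\<close> it
  bounds \<open>t\<close> by \<open>C1 K\<close>, so the constant \<open>sqrt 2\<close> must be
  exact and a radius found by averaging would not do. Bounding \<open>K\<close> on both sides is
  what defeats a hyperplane of share \<open>c K^(-C)\<close>: that threshold stays away from zero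
  while all shares tend to zero. The resulting non-implication is a negated eventual statement, so
  it also needs arbitrarily large spaces to exist on the carrier type; they come from prime fields.
  Cardinalities replace dimension theory: one linear condition costs at most a factor
  \<open>q\<close>, and whatever is orthogonal to a whole hyperplane \<open>orth v\<close> has at
  most \<open>q\<close> elements.\<close>

lemma (in field) two_nonzero_of_odd_order:
  assumes "odd (order R)"
  shows "\<one> \<oplus> \<one> \<noteq> \<zero>"
proof
  assume two: "\<one> \<oplus> \<one> = \<zero>"
  \<comment> \<open>If \<open>1 + 1 = 0\<close>, zero and one form an additive subgroup of order
    two, and Lagrange makes the order even.\<close>
  have "subgroup {\<zero>, \<one>} (add_monoid R)"
  proof (intro add.subgroupI)
    show "\<And>a. a \<in> {\<zero>, \<one>} \<Longrightarrow> \<ominus> a \<in> {\<zero>, \<one>}"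
      using two minus_equality[of \<one> \<one>] by auto
  qed (use two in auto)
  then have "card {\<zero>, \<one>} dvd order (add_monoid R)"
    using group.lagrange[OF a_group] by (metis dvd_triv_right)
  with assms show False
    by (simp add: order_def flip: numeral_2_eq_2)
qed

section \<open>Finite quadratic spaces\<close>

text \<open>Dimension enters only as the cardinality \<open>order R ^ d\<close>, so the arguments
  count vectors instead of choosing bases; the coordinate space is one instance.\<close>

locale finite_quadratic_space = Module.module R M + field R
  for R (structure) and M (structure) +
  fixes Q :: "'c \<Rightarrow> 'a" and d :: nat
  assumes finite_scalars: "finite (carrier R)"
    and odd_order: "odd (order R)"
    and card_vectors: "card (carrier M) = order R ^ d"
    and form: "quadratic_form R M Q"
    and nondeg: "nondegenerate R M Q"
begin

abbreviation ip where "ip \<equiv> qinner R M Q"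
abbreviation q where "q \<equiv> order R"

lemmas two_nonzero = two_nonzero_of_odd_order[OF odd_order]

lemma half_closed: "inv (\<one> \<oplus> \<one>) \<in> carrier R" and half: "(\<one> \<oplus> \<one>) \<otimes> inv (\<one> \<oplus> \<one>) = \<one>"
  using two_nonzero field_Units by auto

lemma double_cancel:
  assumes "a \<in> carrier R" "a \<oplus> a = \<zero>" shows "a = \<zero>"
proof -
  have "(\<one> \<oplus> \<one>) \<otimes> a = \<zero>"
    using assms by (simp add: l_distr)
  then show ?thesis
    using two_nonzero assms integral by blast
qed

section \<open>Calculus of the form and its polarisation\<close>

lemma Q_closed [simp, intro]: "x \<in> carrier M \<Longrightarrow> Q x \<in> carrier R"
  and Q_smult: "a \<in> carrier R \<Longrightarrow> x \<in> carrier M \<Longrightarrow> Q (a \<odot>\<^bsub>M\<^esub> x) = a \<otimes> a \<otimes> Q x"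
  and ip_add_left: "x \<in> carrier M \<Longrightarrow> y \<in> carrier M \<Longrightarrow> z \<in> carrier M \<Longrightarrow>
    ip (x \<oplus>\<^bsub>M\<^esub> y) z = ip x z \<oplus> ip y z"
  and ip_smult_left: "a \<in> carrier R \<Longrightarrow> x \<in> carrier M \<Longrightarrow> y \<in> carrier M \<Longrightarrow>
    ip (a \<odot>\<^bsub>M\<^esub> x) y = a \<otimes> ip x y"
  using form unfolding quadratic_form_def by auto

lemma ip_closed [simp, intro]: "x \<in> carrier M \<Longrightarrow> y \<in> carrier M \<Longrightarrow> ip x y \<in> carrier R"
  unfolding qinner_def using half_closed by auto

lemma ip_commute: "x \<in> carrier M \<Longrightarrow> y \<in> carrier M \<Longrightarrow> ip x y = ip y x"
proof -
  have "a \<ominus> b \<ominus> c = a \<ominus> c \<ominus> b" if "a \<in> carrier R" "b \<in> carrier R" "c \<in> carrier R" for a b c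
    using that by algebra
  then show "x \<in> carrier M \<Longrightarrow> y \<in> carrier M \<Longrightarrow> ip x y = ip y x"
    unfolding qinner_def by (simp add: M.a_comm)
qed

lemma ip_add_right: "x \<in> carrier M \<Longrightarrow> y \<in> carrier M \<Longrightarrow> z \<in> carrier M \<Longrightarrow>
    ip z (x \<oplus>\<^bsub>M\<^esub> y) = ip z x \<oplus> ip z y"
  by (simp add: ip_commute[of z] ip_add_left)

lemma ip_smult_right: "a \<in> carrier R \<Longrightarrow> x \<in> carrier M \<Longrightarrow> y \<in> carrier M \<Longrightarrow>
    ip y (a \<odot>\<^bsub>M\<^esub> x) = a \<otimes> ip y x"
  by (simp add: ip_commute[of y] ip_smult_left)

lemma ip_uminus_left: "x \<in> carrier M \<Longrightarrow> y \<in> carrier M \<Longrightarrow> ip (\<ominus>\<^bsub>M\<^esub> x) y = \<ominus> ip x y"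
  using ip_smult_left[of "\<ominus> \<one>" x y] by (simp add: smult_l_minus l_minus)

lemma ip_minus_left: "x \<in> carrier M \<Longrightarrow> y \<in> carrier M \<Longrightarrow> z \<in> carrier M \<Longrightarrow>
    ip (x \<ominus>\<^bsub>M\<^esub> y) z = ip x z \<ominus> ip y z"
  by (simp add: a_minus_def ip_add_left ip_uminus_left)

lemma ip_zero_left [simp]: "y \<in> carrier M \<Longrightarrow> ip \<zero>\<^bsub>M\<^esub> y = \<zero>"
  using ip_smult_left[of \<zero> "\<zero>\<^bsub>M\<^esub>" y] by simp

lemma Q_add:
  assumes "x \<in> carrier M" "y \<in> carrier M"
  shows "Q (x \<oplus>\<^bsub>M\<^esub> y) = Q x \<oplus> Q y \<oplus> (ip x y \<oplus> ip x y)"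
proof -
  have "ip x y \<oplus> ip x y = (Q (x \<oplus>\<^bsub>M\<^esub> y) \<ominus> Q x \<ominus> Q y) \<otimes> ((\<one> \<oplus> \<one>) \<otimes> inv (\<one> \<oplus> \<one>))"
    unfolding qinner_def using assms half_closed by (simp add: r_distr l_distr)
  also have "\<dots> = Q (x \<oplus>\<^bsub>M\<^esub> y) \<ominus> Q x \<ominus> Q y"
    using assms half by simp
  moreover have "a = b \<oplus> c \<oplus> (a \<ominus> b \<ominus> c)" if "a \<in> carrier R" "b \<in> carrier R" "c \<in> carrier R" for a b c
    using that by algebra
  ultimately show ?thesis
    using assms by simp
qed

lemma ip_self:
  assumes "x \<in> carrier M"
  shows "ip x x = Q x"
proof -
  have "x \<oplus>\<^bsub>M\<^esub> x = (\<one> \<oplus> \<one>) \<odot>\<^bsub>M\<^esub> x"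
    using assms by (simp add: smult_l_distr)
  then have "Q (x \<oplus>\<^bsub>M\<^esub> x) = (\<one> \<oplus> \<one>) \<otimes> (\<one> \<oplus> \<one>) \<otimes> Q x"
    using assms by (simp add: Q_smult)
  moreover have "(\<one> \<oplus> \<one>) \<otimes> (\<one> \<oplus> \<one>) \<otimes> a \<ominus> a \<ominus> a = (\<one> \<oplus> \<one>) \<otimes> a" if "a \<in> carrier R" for a
    using that by (simp add: l_distr r_distr) algebra
  ultimately have "ip x x = (\<one> \<oplus> \<one>) \<otimes> Q x \<otimes> inv (\<one> \<oplus> \<one>)"
    unfolding qinner_def using assms by simp
  also have "\<dots> = Q x \<otimes> ((\<one> \<oplus> \<one>) \<otimes> inv (\<one> \<oplus> \<one>))"
    using assms half_closed by (simp add: m_ac)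
  finally show ?thesis using assms half by simp
qed

lemma Q_line:
  assumes "x \<in> carrier M" "e \<in> carrier M" "s \<in> carrier R"
  shows "Q (x \<oplus>\<^bsub>M\<^esub> s \<odot>\<^bsub>M\<^esub> e) = Q x \<oplus> s \<otimes> s \<otimes> Q e \<oplus> s \<otimes> (ip x e \<oplus> ip x e)"
  using assms by (simp add: Q_add Q_smult ip_smult_right r_distr)

lemma q_pos: "q > 0" and q_ge_3: "q \<ge> 3"
proof -
  have "card {\<zero>, \<one>} \<le> q"
    unfolding order_def using finite_scalars by (intro card_mono) auto
  then have "q \<ge> 2" by simp
  moreover have "q \<noteq> 2" using odd_order by auto
  ultimately show "q \<ge> 3" "q > 0" by auto
qed

lemma finite_vectors: "finite (carrier M)"
  using card_vectors q_pos by (metis card.infinite power_eq_0_iff less_numeral_extra(3))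

section \<open>Level sets of the form on lines\<close>

lemma card_roots_le_2:
  assumes "x \<in> carrier M" "e \<in> carrier M" "Q e \<noteq> \<zero>"
  shows "card {s \<in> carrier R. Q (x \<oplus>\<^bsub>M\<^esub> s \<odot>\<^bsub>M\<^esub> e) = r} \<le> 2" (is "card ?S \<le> 2")
proof (cases "?S = {}")
  case False
  then obtain s where s: "s \<in> ?S" by blast
  \<comment> \<open>Vieta: on the line, the two roots sum to minus twice \<open>ip x e\<close>
    divided by \<open>Q e\<close>, so \<open>?c\<close> is the partner of \<open>s\<close>.\<close>
  let ?c = "\<ominus> (ip x e \<oplus> ip x e) \<otimes> inv (Q e) \<ominus> s"
  have inv: "inv (Q e) \<in> carrier R" "Q e \<otimes> inv (Q e) = \<one>"
    using assms field_Units by auto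
  have "u = s \<or> u = ?c" if u: "u \<in> ?S" for u
  proof -
    have c: "u \<in> carrier R" "s \<in> carrier R" "Q e \<in> carrier R" "ip x e \<in> carrier R" "Q x \<in> carrier R"
      using u s assms by auto
    have "Q x \<oplus> u \<otimes> u \<otimes> Q e \<oplus> u \<otimes> (ip x e \<oplus> ip x e) = Q x \<oplus> s \<otimes> s \<otimes> Q e \<oplus> s \<otimes> (ip x e \<oplus> ip x e)"
      using u s assms by (simp flip: Q_line)
    then have "(Q x \<oplus> u \<otimes> u \<otimes> Q e \<oplus> u \<otimes> (ip x e \<oplus> ip x e)) \<ominus> (Q x \<oplus> s \<otimes> s \<otimes> Q e \<oplus> s \<otimes> (ip x e \<oplus> ip x e)) = \<zero>"
      using c by (simp add: a_minus_def R.r_neg)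
    moreover have "(Q x \<oplus> u \<otimes> u \<otimes> Q e \<oplus> u \<otimes> (ip x e \<oplus> ip x e)) \<ominus> (Q x \<oplus> s \<otimes> s \<otimes> Q e \<oplus> s \<otimes> (ip x e \<oplus> ip x e))
      = (u \<ominus> s) \<otimes> ((u \<oplus> s) \<otimes> Q e \<oplus> (ip x e \<oplus> ip x e))"
      using c by algebra
    ultimately have "(u \<ominus> s) \<otimes> ((u \<oplus> s) \<otimes> Q e \<oplus> (ip x e \<oplus> ip x e)) = \<zero>"
      by simp
    then consider "u \<ominus> s = \<zero>" | "(u \<oplus> s) \<otimes> Q e \<oplus> (ip x e \<oplus> ip x e) = \<zero>"
      using c integral_iff[of "u \<ominus> s" "(u \<oplus> s) \<otimes> Q e \<oplus> (ip x e \<oplus> ip x e)"] by auto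
    then show ?thesis
    proof cases
      case 1
      then show ?thesis using c by (simp add: R.r_right_minus_eq)
    next
      case 2
      then have "((u \<oplus> s) \<otimes> Q e \<oplus> (ip x e \<oplus> ip x e)) \<otimes> inv (Q e) = \<zero>"
        using inv by simp
      moreover have "((u \<oplus> s) \<otimes> Q e \<oplus> (ip x e \<oplus> ip x e)) \<otimes> inv (Q e) =
        (u \<oplus> s) \<otimes> (Q e \<otimes> inv (Q e)) \<oplus> (ip x e \<oplus> ip x e) \<otimes> inv (Q e)"
        using c inv(1) by algebra
      ultimately have "u \<oplus> s \<oplus> (ip x e \<oplus> ip x e) \<otimes> inv (Q e) = \<zero>"
        using c inv by simp
      moreover have "u = (u \<oplus> s \<oplus> (ip x e \<oplus> ip x e) \<otimes> inv (Q e)) \<oplus> ?c"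
        using c inv(1) by algebra
      ultimately have "u = ?c" using c inv(1) by simp
      then show ?thesis ..
    qed
  qed
  then have "?S \<subseteq> {s, ?c}" by blast
  then have "card ?S \<le> card {s, ?c}"
    by (intro card_mono) auto
  then show ?thesis
    using card_insert_le_m1[of 2 "{?c}" s] by simp
next
  case True
  show ?thesis unfolding True by simp
qed

text \<open>Double counting of the pairs \<open>(x, s)\<close> with \<open>x + s e\<close> in
  \<open>T\<close>. Shifting a point of \<open>T\<close> back by each \<open>s\<close> stays in
  \<open>S\<close>, which yields \<open>q * card T\<close> pairs; each base point contributes at
  most \<open>k\<close>. Admitting every point of a line as base point avoids the quotient by
  \<open>e\<close>.\<close>

lemma line_count:
  assumes S: "S \<subseteq> carrier M" "T \<subseteq> S" and e: "e \<in> carrier M"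
    and closed: "\<And>x s. x \<in> S \<Longrightarrow> s \<in> carrier R \<Longrightarrow> x \<oplus>\<^bsub>M\<^esub> s \<odot>\<^bsub>M\<^esub> e \<in> S"
    and bound: "\<And>x. x \<in> S \<Longrightarrow> card {s \<in> carrier R. x \<oplus>\<^bsub>M\<^esub> s \<odot>\<^bsub>M\<^esub> e \<in> T} \<le> k"
  shows "q * card T \<le> k * card S"
proof -
  let ?Z = "SIGMA x:S. {s \<in> carrier R. x \<oplus>\<^bsub>M\<^esub> s \<odot>\<^bsub>M\<^esub> e \<in> T}"
  have fin: "finite S"
    using S finite_vectors finite_subset by blast
  have shift: "(x \<oplus>\<^bsub>M\<^esub> (\<ominus> s) \<odot>\<^bsub>M\<^esub> e) \<oplus>\<^bsub>M\<^esub> s \<odot>\<^bsub>M\<^esub> e = x" if "x \<in> carrier M" "s \<in> carrier R" for x s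
    using that e by (simp add: M.a_assoc M.l_neg smult_l_minus)
  have "q * card T = card (carrier R \<times> T)"
    by (simp add: card_cartesian_product order_def)
  also have "\<dots> \<le> card ?Z"
  proof (rule card_inj_on_le)
    show "inj_on (\<lambda>(s, x). (x \<oplus>\<^bsub>M\<^esub> (\<ominus> s) \<odot>\<^bsub>M\<^esub> e, s)) (carrier R \<times> T)"
    proof (intro inj_onI, clarsimp)
      fix x y s assume "s \<in> carrier R" "x \<in> T" "y \<in> T" "x \<oplus>\<^bsub>M\<^esub> \<ominus> s \<odot>\<^bsub>M\<^esub> e = y \<oplus>\<^bsub>M\<^esub> \<ominus> s \<odot>\<^bsub>M\<^esub> e"
      moreover have "x \<in> carrier M" "y \<in> carrier M" using S calculation by auto
      ultimately show "x = y" using shift by metis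
    qed
    show "(\<lambda>(s, x). (x \<oplus>\<^bsub>M\<^esub> (\<ominus> s) \<odot>\<^bsub>M\<^esub> e, s)) ` (carrier R \<times> T) \<subseteq> ?Z"
      using S closed shift by (auto dest: subsetD)
    show "finite ?Z"
      using fin finite_scalars by auto
  qed
  also have "\<dots> = (\<Sum>x\<in>S. card {s \<in> carrier R. x \<oplus>\<^bsub>M\<^esub> s \<odot>\<^bsub>M\<^esub> e \<in> T})"
    using fin finite_scalars by (intro card_SigmaI) auto
  also have "\<dots> \<le> (\<Sum>x\<in>S. k)"
    by (intro sum_mono bound)
  finally show ?thesis
    by (simp add: mult.commute)
qed

section \<open>Linear functionals, kernels and fibres\<close>

definition linear_functional :: "('c \<Rightarrow> 'a) \<Rightarrow> bool" where
  "linear_functional f \<longleftrightarrow> f \<in> carrier M \<rightarrow> carrier R \<and>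
    (\<forall>x\<in>carrier M. \<forall>y\<in>carrier M. f (x \<oplus>\<^bsub>M\<^esub> y) = f x \<oplus> f y) \<and>
    (\<forall>a\<in>carrier R. \<forall>x\<in>carrier M. f (a \<odot>\<^bsub>M\<^esub> x) = a \<otimes> f x)"

lemma linear_functionalD:
  assumes "linear_functional f"
  shows "x \<in> carrier M \<Longrightarrow> f x \<in> carrier R"
    and "x \<in> carrier M \<Longrightarrow> y \<in> carrier M \<Longrightarrow> f (x \<oplus>\<^bsub>M\<^esub> y) = f x \<oplus> f y"
    and "a \<in> carrier R \<Longrightarrow> x \<in> carrier M \<Longrightarrow> f (a \<odot>\<^bsub>M\<^esub> x) = a \<otimes> f x"
    and "x \<in> carrier M \<Longrightarrow> y \<in> carrier M \<Longrightarrow> f (x \<ominus>\<^bsub>M\<^esub> y) = f x \<ominus> f y"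
    and "f \<zero>\<^bsub>M\<^esub> = \<zero>"
proof -
  show *: "x \<in> carrier M \<Longrightarrow> f x \<in> carrier R"
    "x \<in> carrier M \<Longrightarrow> y \<in> carrier M \<Longrightarrow> f (x \<oplus>\<^bsub>M\<^esub> y) = f x \<oplus> f y"
    "a \<in> carrier R \<Longrightarrow> x \<in> carrier M \<Longrightarrow> f (a \<odot>\<^bsub>M\<^esub> x) = a \<otimes> f x" for x y a
    using assms by (auto simp: linear_functional_def)
  have "f (\<ominus>\<^bsub>M\<^esub> y) = \<ominus> f y" if "y \<in> carrier M"
    using *(3)[of "\<ominus> \<one>" y] *(1)[of y] that by (simp add: smult_l_minus l_minus)
  then show "x \<in> carrier M \<Longrightarrow> y \<in> carrier M \<Longrightarrow> f (x \<ominus>\<^bsub>M\<^esub> y) = f x \<ominus> f y"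
    by (simp add: a_minus_def *)
  show "f \<zero>\<^bsub>M\<^esub> = \<zero>"
    using *(3)[of \<zero> "\<zero>\<^bsub>M\<^esub>"] *(1)[of "\<zero>\<^bsub>M\<^esub>"] by simp
qed

lemma linear_functional_ip: "v \<in> carrier M \<Longrightarrow> linear_functional (\<lambda>x. ip x v)"
  by (auto simp: linear_functional_def ip_add_left ip_smult_left)

lemma submodule_minus:
  assumes "submodule S R M" "x \<in> S" "y \<in> S" shows "x \<ominus>\<^bsub>M\<^esub> y \<in> S"
  unfolding a_minus_def
  by (rule submoduleE(5)[OF assms(1) assms(2) submoduleE(3)[OF assms(1,3)]])

lemma zero_in_submodule:
  assumes "submodule S R M" shows "\<zero>\<^bsub>M\<^esub> \<in> S"
proof -
  obtain x where x: "x \<in> S" "x \<in> carrier M"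
    using submoduleE(1,2)[OF assms] by blast
  then show ?thesis
    using submoduleE(4)[OF assms R.zero_closed x(1)] by simp
qed

lemma submodule_kernel:
  assumes S: "submodule S R M" and f: "linear_functional f"
  shows "submodule {x \<in> S. f x = \<zero>} R M"
proof (rule submoduleI)
  note E = submoduleE[OF S] and F = linear_functionalD[OF f]
  show "{x \<in> S. f x = \<zero>} \<subseteq> carrier M" using E(1) by auto
  show "\<zero>\<^bsub>M\<^esub> \<in> {x \<in> S. f x = \<zero>}" using zero_in_submodule[OF S] F(5) by simp
  show "\<ominus>\<^bsub>M\<^esub> x \<in> {x \<in> S. f x = \<zero>}" if "x \<in> {x \<in> S. f x = \<zero>}" for x
  proof -
    have "x \<in> carrier M" using that E by auto
    then have "\<ominus>\<^bsub>M\<^esub> x = (\<ominus> \<one>) \<odot>\<^bsub>M\<^esub> x" by (simp add: smult_l_minus)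
    then show ?thesis using that E(4)[of "\<ominus> \<one>" x] F(3)[of "\<ominus> \<one>" x] \<open>x \<in> carrier M\<close> by simp
  qed
  show "x \<oplus>\<^bsub>M\<^esub> y \<in> {x \<in> S. f x = \<zero>}" if "x \<in> {x \<in> S. f x = \<zero>}" "y \<in> {x \<in> S. f x = \<zero>}" for x y
  proof -
    have "x \<in> carrier M" "y \<in> carrier M" using that E(1) by auto
    with that E(5)[of x y] F(2)[of x y] show ?thesis by simp
  qed
  show "a \<odot>\<^bsub>M\<^esub> x \<in> {x \<in> S. f x = \<zero>}" if "a \<in> carrier R" "x \<in> {x \<in> S. f x = \<zero>}" for a x
  proof -
    have "x \<in> carrier M" using that E(1) by auto
    with that E(4)[of a x] F(3)[of a x] show ?thesis by simp
  qed
qed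

lemma unit_vector:
  assumes S: "submodule S R M" and f: "linear_functional f" and e: "e \<in> S" "f e \<noteq> \<zero>"
  obtains e' where "e' \<in> S" "f e' = \<one>"
proof -
  note E = submoduleE[OF S] and F = linear_functionalD[OF f]
  have e': "e \<in> carrier M" using e(1) E(1) by blast
  then have "f e \<in> Units R" using e(2) F(1)[of e] by (simp add: field_Units)
  then have u: "inv (f e) \<in> carrier R" "inv (f e) \<otimes> f e = \<one>"
    by auto
  show thesis
  proof (rule that)
    show "inv (f e) \<odot>\<^bsub>M\<^esub> e \<in> S"
      by (rule E(4)[OF u(1) e(1)])
    show "f (inv (f e) \<odot>\<^bsub>M\<^esub> e) = \<one>"
      using F(3)[OF u(1) e'] u(2) by (rule trans)
  qed
qed

text \<open>Rank-nullity in cardinalities: a vector \<open>e'\<close> with \<open>f e' = 1\<close>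
  translates the kernel onto every fibre, and the \<open>q\<close> fibres partition
  \<open>S\<close>.\<close>

lemma
  assumes S: "submodule S R M" and f: "linear_functional f" and e: "e \<in> S" "f e \<noteq> \<zero>"
  shows card_fibre: "b \<in> carrier R \<Longrightarrow> card {x \<in> S. f x = b} = card {x \<in> S. f x = \<zero>}"
    and card_kernel: "card S = q * card {x \<in> S. f x = \<zero>}"
proof -
  obtain e' where e': "e' \<in> S" "f e' = \<one>"
    using unit_vector[OF assms] .
  note E = submoduleE[OF S] and F = linear_functionalD[OF f]
  have e'': "e' \<in> carrier M" using e' E(1) by auto
  show fibre: "card {x \<in> S. f x = b} = card {x \<in> S. f x = \<zero>}" if b: "b \<in> carrier R" for b
  proof (rule bij_betw_same_card, rule bij_betw_byWitness[where
        f = "\<lambda>x. x \<ominus>\<^bsub>M\<^esub> b \<odot>\<^bsub>M\<^esub> e'" and f' = "\<lambda>x. x \<oplus>\<^bsub>M\<^esub> b \<odot>\<^bsub>M\<^esub> e'"])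
    show "\<forall>x\<in>{x \<in> S. f x = b}. x \<ominus>\<^bsub>M\<^esub> b \<odot>\<^bsub>M\<^esub> e' \<oplus>\<^bsub>M\<^esub> b \<odot>\<^bsub>M\<^esub> e' = x"
      using b e'' E(1) by (auto simp: a_minus_def M.a_assoc M.l_neg)
    show "\<forall>x\<in>{x \<in> S. f x = \<zero>}. x \<oplus>\<^bsub>M\<^esub> b \<odot>\<^bsub>M\<^esub> e' \<ominus>\<^bsub>M\<^esub> b \<odot>\<^bsub>M\<^esub> e' = x"
      using b e'' E(1) by (auto simp: a_minus_def M.a_assoc M.r_neg)
    show "(\<lambda>x. x \<ominus>\<^bsub>M\<^esub> b \<odot>\<^bsub>M\<^esub> e') ` {x \<in> S. f x = b} \<subseteq> {x \<in> S. f x = \<zero>}"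
    proof safe
      fix x assume x: "x \<in> S" "b = f x"
      then show "x \<ominus>\<^bsub>M\<^esub> f x \<odot>\<^bsub>M\<^esub> e' \<in> S"
        using b E(4)[OF b e'(1)] by (auto intro: submodule_minus[OF S])
      have "x \<in> carrier M" using x E(1) by auto
      with x(2) b e'' e'(2) show "f (x \<ominus>\<^bsub>M\<^esub> f x \<odot>\<^bsub>M\<^esub> e') = \<zero>"
        by (simp add: F(3,4))
    qed
    show "(\<lambda>x. x \<oplus>\<^bsub>M\<^esub> b \<odot>\<^bsub>M\<^esub> e') ` {x \<in> S. f x = \<zero>} \<subseteq> {x \<in> S. f x = b}"
    proof safe
      fix x assume x: "x \<in> S" "f x = \<zero>"
      then show "x \<oplus>\<^bsub>M\<^esub> b \<odot>\<^bsub>M\<^esub> e' \<in> S"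
        using E(5)[OF _ E(4)[OF b e'(1)]] by simp
      have "x \<in> carrier M" using x E(1) by auto
      with x(2) b e'' e'(2) show "f (x \<oplus>\<^bsub>M\<^esub> b \<odot>\<^bsub>M\<^esub> e') = b"
        by (simp add: F(2,3))
    qed
  qed
  have fin: "finite S" using E(1) finite_vectors finite_subset by blast
  have "S = (\<Union>b\<in>carrier R. {x \<in> S. f x = b})"
    using E(1) F(1) by auto
  then have "card S = card (\<Union>b\<in>carrier R. {x \<in> S. f x = b})" by (rule arg_cong)
  also have "\<dots> = (\<Sum>b\<in>carrier R. card {x \<in> S. f x = b})"
    using fin finite_scalars by (intro card_UN_disjoint) auto
  also have "\<dots> = (\<Sum>b\<in>carrier R. card {x \<in> S. f x = \<zero>})"
    by (intro sum.cong fibre refl)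
  also have "\<dots> = q * card {x \<in> S. f x = \<zero>}"
    by (simp add: order_def)
  finally show "card S = q * card {x \<in> S. f x = \<zero>}" .
qed

text \<open>If \<open>f\<close> vanishes on \<open>S\<close>, the kernel is all of \<open>S\<close>;
  thus cutting by one more condition costs at most a factor \<open>q\<close>, with no case split
  left to the user of the bound.\<close>

lemma card_kernel_ge:
  assumes S: "submodule S R M" and f: "linear_functional f"
  shows "card S \<le> q * card {x \<in> S. f x = \<zero>}"
proof (cases "\<exists>e\<in>S. f e \<noteq> \<zero>")
  case True
  then show ?thesis using card_kernel[OF assms] by auto
next
  case False
  then have "{x \<in> S. f x = \<zero>} = S" by auto
  then show ?thesis using q_pos by (simp add: Suc_leI)
qed

section \<open>Orthogonal complements, isotropic and anisotropic vectors\<close>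

abbreviation orth where "orth \<equiv> perp R M Q"

lemma submodule_orth: "v \<in> carrier M \<Longrightarrow> submodule (orth v) R M"
  unfolding perp_def by (intro submodule_kernel carrier_is_submodule linear_functional_ip)

text \<open>Nondegeneracy makes pairing with \<open>v\<close> a nonzero functional. The factor
  \<open>q\<close> stands on the left so that the exponent needs no subtraction.\<close>

lemma card_orth:
  assumes "v \<in> carrier M" "v \<noteq> \<zero>\<^bsub>M\<^esub>"
  shows "q * card (orth v) = q ^ d"
proof -
  obtain y where "y \<in> carrier M" "ip v y \<noteq> \<zero>"
    using nondeg assms unfolding nondegenerate_def by blast
  then have "y \<in> carrier M" "ip y v \<noteq> \<zero>"
    using assms ip_commute by auto
  from card_kernel[OF carrier_is_submodule linear_functional_ip[OF assms(1)] this] show ?thesis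
    by (simp add: perp_def card_vectors)
qed

text \<open>Squaring is at most two-to-one and even one-to-one over zero. That single exception
  pushes the count above \<open>q / 2\<close>, which the pigeonhole argument of
  \<open>solve_binary\<close> requires.\<close>

lemma card_squares: "q + 1 \<le> 2 * card ((\<lambda>x. x \<otimes> x) ` carrier R)"
proof -
  let ?S = "(\<lambda>x. x \<otimes> x) ` carrier R"
  have fin: "finite ?S" using finite_scalars by simp
  have z: "\<zero> \<in> ?S" by (rule image_eqI[of _ _ \<zero>]) auto
  have le2: "card {x \<in> carrier R. x \<otimes> x = y} \<le> 2" if y: "y \<in> ?S" for y
  proof -
    obtain u where u: "u \<in> carrier R" "y = u \<otimes> u" using y by auto
    have "x = u \<or> x = \<ominus> u" if x: "x \<in> carrier R" "x \<otimes> x = u \<otimes> u" for x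
    proof -
      have "(x \<ominus> u) \<otimes> (x \<oplus> u) = x \<otimes> x \<ominus> u \<otimes> u"
        using x(1) u(1) by algebra
      then have "(x \<ominus> u) \<otimes> (x \<oplus> u) = \<zero>"
        using x u by (simp add: a_minus_def R.r_neg)
      then have "x \<ominus> u = \<zero> \<or> x \<oplus> u = \<zero>"
        using x u integral[of "x \<ominus> u" "x \<oplus> u"] by simp
      then show ?thesis
        using x u R.minus_equality by (auto simp: R.r_right_minus_eq)
    qed
    then have "{x \<in> carrier R. x \<otimes> x = y} \<subseteq> {u, \<ominus> u}" using u by auto
    then have "card {x \<in> carrier R. x \<otimes> x = y} \<le> card {u, \<ominus> u}" by (intro card_mono) auto
    then show ?thesis using card_insert_le_m1[of 2 "{\<ominus> u}" u] by simp
  qed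
  have zero: "{x \<in> carrier R. x \<otimes> x = \<zero>} = {\<zero>}" using integral by auto
  have "carrier R = (\<Union>y\<in>?S. {x \<in> carrier R. x \<otimes> x = y})" by auto
  then have "q = card (\<Union>y\<in>?S. {x \<in> carrier R. x \<otimes> x = y})"
    unfolding order_def by (rule arg_cong)
  also have "\<dots> \<le> (\<Sum>y\<in>?S. card {x \<in> carrier R. x \<otimes> x = y})"
    using fin by (rule card_UN_le)
  also have "\<dots> = 1 + (\<Sum>y\<in>?S - {\<zero>}. card {x \<in> carrier R. x \<otimes> x = y})"
    using fin z zero by (simp add: sum.remove)
  also have "\<dots> \<le> 1 + (\<Sum>y\<in>?S - {\<zero>}. 2)"
    using le2 by (intro add_left_mono sum_mono) auto
  also have "\<dots> = 1 + 2 * (card ?S - 1)"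
    using fin z by simp
  finally have "q \<le> 1 + 2 * (card ?S - 1)" .
  moreover have "card ?S > 0"
    using fin z by (metis card_gt_0_iff empty_iff)
  ultimately show ?thesis
    by linarith
qed

lemma exists_nonzero:
  assumes "finite S" "card S > 1" obtains x where "x \<in> S" "x \<noteq> \<zero>\<^bsub>M\<^esub>"
proof -
  have "\<not> S \<subseteq> {\<zero>\<^bsub>M\<^esub>}"
    using assms card_mono[of "{\<zero>\<^bsub>M\<^esub>}" S] by auto
  then show thesis using that by blast
qed

lemma orth_subset: "orth v \<subseteq> carrier M"
  by (auto simp: perp_def)

lemma finite_orth: "finite (orth v)"
  using orth_subset finite_vectors by (rule finite_subset)

text \<open>Pigeonhole: as \<open>s\<close> runs over the squares, \<open>s a\<close> and
  \<open>-(s b + c)\<close> each take more than \<open>q / 2\<close> values, because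
  \<open>a\<close> and \<open>b\<close> are nonzero. The two value sets therefore meet.\<close>

lemma solve_binary:
  assumes a: "a \<in> carrier R" "a \<noteq> \<zero>" and b: "b \<in> carrier R" "b \<noteq> \<zero>" and c: "c \<in> carrier R"
  obtains x y where "x \<in> carrier R" "y \<in> carrier R"
    "x \<otimes> x \<otimes> a \<oplus> y \<otimes> y \<otimes> b \<oplus> c = \<zero>"
proof -
  define Sq where "Sq = (\<lambda>x. x \<otimes> x) ` carrier R"
  have Sq: "Sq \<subseteq> carrier R" "finite Sq"
    using finite_scalars by (auto simp: Sq_def)
  let ?A = "(\<lambda>s. s \<otimes> a) ` Sq" and ?B = "(\<lambda>s. \<ominus> (s \<otimes> b \<oplus> c)) ` Sq"
  have "inj_on (\<lambda>s. s \<otimes> a) Sq"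
  proof (rule inj_onI)
    fix s u assume "s \<in> Sq" "u \<in> Sq" "s \<otimes> a = u \<otimes> a"
    moreover from this have "s \<in> carrier R" "u \<in> carrier R" using Sq by auto
    ultimately show "s = u" using a by (simp add: m_rcancel)
  qed
  then have A: "card ?A = card Sq" by (rule card_image)
  have "inj_on (\<lambda>s. \<ominus> (s \<otimes> b \<oplus> c)) Sq"
  proof (rule inj_onI)
    fix s u assume su: "s \<in> Sq" "u \<in> Sq" and eq: "\<ominus> (s \<otimes> b \<oplus> c) = \<ominus> (u \<otimes> b \<oplus> c)"
    then have "s \<in> carrier R" "u \<in> carrier R" using Sq by auto
    moreover have "\<ominus> (\<ominus> (s \<otimes> b \<oplus> c)) = \<ominus> (\<ominus> (u \<otimes> b \<oplus> c))"
      using eq by (rule arg_cong)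
    ultimately show "s = u" using b c by (simp add: m_rcancel)
  qed
  then have B: "card ?B = card Sq" by (rule card_image)
  have "?A \<subseteq> carrier R" "?B \<subseteq> carrier R"
    using a b c Sq(1) by (simp_all add: image_subset_iff subsetD[OF Sq(1)])
  then have "card (?A \<union> ?B) \<le> q"
    unfolding order_def by (intro card_mono finite_scalars Un_least)
  moreover have "card ?A + card ?B > q"
    using A B card_squares by (simp add: Sq_def)
  moreover have "card (?A \<union> ?B) = card ?A + card ?B" if "?A \<inter> ?B = {}"
    using that Sq(2) by (intro card_Un_disjoint finite_imageI)
  ultimately have "?A \<inter> ?B \<noteq> {}"
    by linarith
  then obtain s u where su: "s \<in> Sq" "u \<in> Sq" "s \<otimes> a = \<ominus> (u \<otimes> b \<oplus> c)" by blast
  then obtain x y where xy: "x \<in> carrier R" "y \<in> carrier R" "s = x \<otimes> x" "u = y \<otimes> y"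
    by (auto simp: Sq_def)
  have "x \<otimes> x \<otimes> a \<oplus> y \<otimes> y \<otimes> b \<oplus> c = \<ominus> (y \<otimes> y \<otimes> b \<oplus> c) \<oplus> (y \<otimes> y \<otimes> b \<oplus> c)"
    using xy su a b c by (simp add: R.a_assoc)
  also have "\<dots> = \<zero>"
    using xy b c by (intro R.l_neg) simp
  finally show thesis
    using that xy by blast
qed

text \<open>
  If \<open>Q\<close> were anisotropic, there would be three orthogonal vectors with nonzero values, and \<open>Q\<close>
  would vanish at some \<open>x e1 + y e2 + e3\<close>.
\<close>

lemma exists_isotropic:
  assumes d: "d \<ge> 3"
  obtains v where "v \<in> carrier M" "v \<noteq> \<zero>\<^bsub>M\<^esub>" "Q v = \<zero>"
proof (rule ccontr)
  assume neg: "\<not> thesis"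
  then have an: "Q x \<noteq> \<zero>" if "x \<in> carrier M" "x \<noteq> \<zero>\<^bsub>M\<^esub>" for x
    using that \<open>\<And>v. \<lbrakk>v \<in> carrier M; v \<noteq> \<zero>\<^bsub>M\<^esub>; Q v = \<zero>\<rbrakk> \<Longrightarrow> thesis\<close> by blast
  \<comment> \<open>At least \<open>q^3\<close> vectors are available. Orthogonality to
    \<open>e1\<close> leaves at least \<open>q^2\<close> of them, and orthogonality to
    \<open>e2\<close> as well leaves at least \<open>q\<close>, enough for a nonzero
    \<open>e3\<close>.\<close>
  have "q ^ d \<ge> q ^ 3"
    using d q_pos by (intro power_increasing) auto
  moreover have q3: "q ^ 3 = q * (q * q)" by (simp add: power3_eq_cube)
  ultimately have big: "q * (q * q) \<le> q ^ d" by simp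
  have "1 * 1 < q * q"
    using q_ge_3 by (intro mult_strict_mono) auto
  then have q1: "q * q > 1" by simp
  have "1 * 1 < q * (q * q)"
    using q_ge_3 q1 by (intro mult_strict_mono) auto
  then have "card (carrier M) > 1"
    using big card_vectors by simp
  then obtain e1 where e1: "e1 \<in> carrier M" "e1 \<noteq> \<zero>\<^bsub>M\<^esub>"
    using exists_nonzero[OF finite_vectors] by blast
  note V1 = submodule_orth[OF e1(1)]
  have "q * (q * q) \<le> q * card (orth e1)"
    using card_orth[OF e1] big by simp
  then have c1: "q * q \<le> card (orth e1)"
    using q_pos by simp
  then obtain e2 where e2: "e2 \<in> orth e1" "e2 \<noteq> \<zero>\<^bsub>M\<^esub>"
    using exists_nonzero[OF finite_orth, of e1] q1 by auto
  then have e2M: "e2 \<in> carrier M" using orth_subset by blast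
  have "q * q \<le> q * card {x \<in> orth e1. ip x e2 = \<zero>}"
    using c1 card_kernel_ge[OF V1 linear_functional_ip[OF e2M]] by linarith
  then have "card {x \<in> orth e1. ip x e2 = \<zero>} > 1"
    using q_ge_3 by auto
  then obtain e3 where e3: "e3 \<in> orth e1" "ip e3 e2 = \<zero>" "e3 \<noteq> \<zero>\<^bsub>M\<^esub>"
    using exists_nonzero[of "{x \<in> orth e1. ip x e2 = \<zero>}"] finite_orth by auto
  then have e3M: "e3 \<in> carrier M" using orth_subset by blast
  obtain x y where xy: "x \<in> carrier R" "y \<in> carrier R"
    "x \<otimes> x \<otimes> Q e1 \<oplus> y \<otimes> y \<otimes> Q e2 \<oplus> Q e3 = \<zero>"
    using solve_binary[of "Q e1" "Q e2" "Q e3"] an e1 e2 e3 e2M e3M by blast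
  have ips: "ip e1 e2 = \<zero>" "ip e1 e3 = \<zero>" "ip e2 e3 = \<zero>"
    using e1 e2 e3 e2M e3M by (auto simp: perp_def ip_commute)
  let ?u = "x \<odot>\<^bsub>M\<^esub> e1 \<oplus>\<^bsub>M\<^esub> y \<odot>\<^bsub>M\<^esub> e2 \<oplus>\<^bsub>M\<^esub> e3"
  have u: "?u \<in> carrier M" using xy e1 e2M e3M by auto
  have "Q ?u = \<zero>"
    using xy e1 e2M e3M ips by (simp add: Q_add Q_smult ip_add_left ip_smult_left ip_smult_right)
  \<comment> \<open>The coefficient of \<open>e3\<close> is one, so pairing with \<open>e3\<close>
    shows that \<open>?u\<close> is nonzero even when \<open>x\<close> and \<open>y\<close> both
    vanish.\<close>
  moreover have "ip ?u e3 = Q e3"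
    using xy e1 e2M e3M ips by (simp add: ip_add_left ip_smult_left ip_self)
  then have "?u \<noteq> \<zero>\<^bsub>M\<^esub>"
    using an[OF e3M e3(3)] e3M by (metis ip_zero_left)
  ultimately show False using an u by blast
qed

lemma exists_dual:
  assumes v: "v \<in> carrier M" "v \<noteq> \<zero>\<^bsub>M\<^esub>"
  obtains w where "w \<in> carrier M" "ip w v = \<one>"
proof -
  obtain y where "y \<in> carrier M" "ip v y \<noteq> \<zero>"
    using nondeg v unfolding nondegenerate_def by blast
  then have "y \<in> carrier M" "ip y v \<noteq> \<zero>"
    using v ip_commute by auto
  then show thesis
    using unit_vector[OF carrier_is_submodule linear_functional_ip[OF v(1)]] that by blast
qed

text \<open>Every \<open>y\<close> splits as \<open>z + <y,v> w\<close> with \<open>z\<close> in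
  \<open>orth v\<close>. Pairing \<open>x - <x,w> v\<close> with \<open>y\<close> gives the same
  value as pairing \<open>x\<close> with \<open>z\<close>, namely zero, and nondegeneracy identifies
  \<open>x\<close> with \<open><x,w> v\<close>.\<close>

lemma orth_orth:
  assumes v: "v \<in> carrier M" "v \<noteq> \<zero>\<^bsub>M\<^esub>" and x: "x \<in> carrier M" "\<And>y. y \<in> orth v \<Longrightarrow> ip x y = \<zero>"
  shows "\<exists>a\<in>carrier R. x = a \<odot>\<^bsub>M\<^esub> v"
proof -
  obtain w where w: "w \<in> carrier M" "ip w v = \<one>"
    using exists_dual[OF v] .
  let ?a = "ip x w"
  have "ip (x \<ominus>\<^bsub>M\<^esub> ?a \<odot>\<^bsub>M\<^esub> v) y = \<zero>" if y: "y \<in> carrier M" for y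
  proof -
    let ?z = "y \<ominus>\<^bsub>M\<^esub> ip y v \<odot>\<^bsub>M\<^esub> w"
    have "?z \<in> orth v"
      using v w y by (auto simp: perp_def ip_minus_left ip_smult_left)
    then have z: "ip ?z x = \<zero>"
      using x v w y by (simp add: ip_commute)
    have "ip (x \<ominus>\<^bsub>M\<^esub> ?a \<odot>\<^bsub>M\<^esub> v) y = ip ?z x"
      using x(1) v w y
      by (simp add: ip_minus_left ip_smult_left ip_commute[of y x] ip_commute[of v y]
          ip_commute[of w x] m_comm)
    then show ?thesis using z by simp
  qed
  then have "x \<ominus>\<^bsub>M\<^esub> ?a \<odot>\<^bsub>M\<^esub> v = \<zero>\<^bsub>M\<^esub>"
    using nondeg x(1) v w unfolding nondegenerate_def by auto
  then have "x = ?a \<odot>\<^bsub>M\<^esub> v"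
    using x(1) v w M.minus_equality[of x "\<ominus>\<^bsub>M\<^esub> (?a \<odot>\<^bsub>M\<^esub> v)"] by (simp add: a_minus_def)
  then show ?thesis using x(1) w by auto
qed

text \<open>This is the obstruction to large totally singular subspaces: anything orthogonal to all
  of \<open>orth v\<close> lies on the line of \<open>v\<close>.\<close>

lemma card_orth_orth:
  assumes v: "v \<in> carrier M" "v \<noteq> \<zero>\<^bsub>M\<^esub>"
    and S: "S \<subseteq> carrier M" "\<And>x y. x \<in> S \<Longrightarrow> y \<in> orth v \<Longrightarrow> ip x y = \<zero>"
  shows "card S \<le> q"
proof -
  have "S \<subseteq> (\<lambda>a. a \<odot>\<^bsub>M\<^esub> v) ` carrier R"
    using orth_orth[OF v] S by blast
  then show ?thesis
    unfolding order_def using finite_scalars by (intro surj_card_le)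
qed

text \<open>By polarisation twice \<open>ip x y\<close> vanishes, and odd order lets the two be
  cancelled.\<close>

lemma ip_zero_of_singular:
  assumes S: "submodule S R M" "\<And>x. x \<in> S \<Longrightarrow> Q x = \<zero>" and "x \<in> S" "y \<in> S"
  shows "ip x y = \<zero>"
proof -
  have "Q x = \<zero>" "Q y = \<zero>" "Q (x \<oplus>\<^bsub>M\<^esub> y) = \<zero>" "x \<in> carrier M" "y \<in> carrier M"
    using assms submoduleE(1,5)[OF S(1)] by auto
  then show ?thesis
    using Q_add[of x y] double_cancel[of "ip x y"] by simp
qed

lemma card_orth_gt:
  assumes d: "d \<ge> 3" and v: "v \<in> carrier M" "v \<noteq> \<zero>\<^bsub>M\<^esub>"
  shows "card (orth v) = q ^ (d - 1)" and "card (orth v) > q"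
proof -
  have "q * card (orth v) = q * q ^ (d - 1)"
    using card_orth[OF v] d by (simp flip: power_Suc)
  then show *: "card (orth v) = q ^ (d - 1)"
    using q_pos by simp
  have "q ^ 1 < q ^ (d - 1)"
    using d q_ge_3 by (intro power_strict_increasing) auto
  then show "card (orth v) > q" using * by simp
qed

text \<open>If \<open>Q\<close> vanished on \<open>orth v\<close>, this space would be orthogonal to
  itself and have at most \<open>q\<close> elements, whereas \<open>d \<ge> 3\<close> gives it
  \<open>q^(d-1) > q\<close>.\<close>

lemma exists_anisotropic:
  assumes d: "d \<ge> 3" and v: "v \<in> carrier M" "v \<noteq> \<zero>\<^bsub>M\<^esub>"
  obtains e where "e \<in> orth v" "Q e \<noteq> \<zero>"
proof (rule ccontr)
  assume "\<not> thesis"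
  then have "Q x = \<zero>" if "x \<in> orth v" for x
    using that \<open>\<And>e. \<lbrakk>e \<in> orth v; Q e \<noteq> \<zero>\<rbrakk> \<Longrightarrow> thesis\<close> by blast
  then have "card (orth v) \<le> q"
    using ip_zero_of_singular[OF submodule_orth[OF v(1)]] orth_subset by (intro card_orth_orth[OF v]) auto
  then show False using card_orth_gt[OF d v] by simp
qed

end

section \<open>Discrepancies of block systems\<close>

text \<open>The integer part of the discrepancy is split off so that additivity over blocks can be
  shown for cardinalities, apart from the real quotient.\<close>

definition incidences where
  "incidences M Q A T = card {(p, S) \<in> A \<times> T. p \<in> qsphere M Q S}"

lemma discrepancy_eq:
  "discrepancy R M Q A T = real (incidences M Q A T) - real (card A) * real (card T) / real (order R)"
  by (simp add: discrepancy_def incidences_def)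

lemma incidences_eq_sum:
  assumes "finite A" "finite T"
  shows "incidences M Q A T = (\<Sum>p\<in>A. card {S \<in> T. p \<in> qsphere M Q S})"
proof -
  have "{(p, S) \<in> A \<times> T. p \<in> qsphere M Q S} = (SIGMA p:A. {S \<in> T. p \<in> qsphere M Q S})"
    by auto
  then show ?thesis
    using assms by (simp add: incidences_def)
qed

lemma incidences_UN:
  assumes "finite I" "disjoint_family_on A I" "disjoint_family_on T I"
    and fin: "\<And>i. i \<in> I \<Longrightarrow> finite (A i)" "\<And>i. i \<in> I \<Longrightarrow> finite (T i)"
  shows "incidences M Q (\<Union>i\<in>I. A i) (\<Union>j\<in>I. T j) = (\<Sum>i\<in>I. \<Sum>j\<in>I. incidences M Q (A i) (T j))"
proof -
  have "incidences M Q (\<Union>i\<in>I. A i) (\<Union>j\<in>I. T j) =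
      (\<Sum>p\<in>(\<Union>i\<in>I. A i). card {S \<in> (\<Union>j\<in>I. T j). p \<in> qsphere M Q S})"
    using assms by (intro incidences_eq_sum) auto
  also have "\<dots> = (\<Sum>i\<in>I. \<Sum>p\<in>A i. card {S \<in> (\<Union>j\<in>I. T j). p \<in> qsphere M Q S})"
    using assms by (intro sum.UNION_disjoint) (auto simp: disjoint_family_on_def)
  also have "\<dots> = (\<Sum>i\<in>I. \<Sum>p\<in>A i. \<Sum>j\<in>I. card {S \<in> T j. p \<in> qsphere M Q S})"
  proof (intro sum.cong refl)
    fix p
    have "{S \<in> (\<Union>j\<in>I. T j). p \<in> qsphere M Q S} = (\<Union>j\<in>I. {S \<in> T j. p \<in> qsphere M Q S})"
      by auto
    moreover have "card (\<Union>j\<in>I. {S \<in> T j. p \<in> qsphere M Q S}) = (\<Sum>j\<in>I. card {S \<in> T j. p \<in> qsphere M Q S})"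
      using assms unfolding disjoint_family_on_def by (intro card_UN_disjoint) (simp_all, blast)
    ultimately show "card {S \<in> (\<Union>j\<in>I. T j). p \<in> qsphere M Q S} = (\<Sum>j\<in>I. card {S \<in> T j. p \<in> qsphere M Q S})"
      by simp
  qed
  also have "\<dots> = (\<Sum>i\<in>I. \<Sum>j\<in>I. \<Sum>p\<in>A i. card {S \<in> T j. p \<in> qsphere M Q S})"
    by (intro sum.cong refl sum.swap)
  also have "\<dots> = (\<Sum>i\<in>I. \<Sum>j\<in>I. incidences M Q (A i) (T j))"
    using fin by (intro sum.cong refl) (simp add: incidences_eq_sum)
  finally show ?thesis .
qed

text \<open>The incidence count and the product of the two cardinalities are both additive over
  disjoint unions in each argument. Hence the discrepancy of a system is the sum over all pairs of
  blocks.\<close>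

lemma discrepancy_UN:
  assumes "finite I" "disjoint_family_on A I" "disjoint_family_on T I"
    and "\<And>i. i \<in> I \<Longrightarrow> finite (A i)" "\<And>i. i \<in> I \<Longrightarrow> finite (T i)"
  shows "discrepancy R M Q (\<Union>i\<in>I. A i) (\<Union>j\<in>I. T j) = (\<Sum>i\<in>I. \<Sum>j\<in>I. discrepancy R M Q (A i) (T j))"
proof -
  have "card (\<Union>i\<in>I. A i) = (\<Sum>i\<in>I. card (A i))" "card (\<Union>i\<in>I. T i) = (\<Sum>i\<in>I. card (T i))"
    using assms by (intro card_UN_disjoint; auto simp: disjoint_family_on_def)+
  then have "real (card (\<Union>i\<in>I. A i)) * real (card (\<Union>i\<in>I. T i)) / real (order R) =
      (\<Sum>i\<in>I. \<Sum>j\<in>I. real (card (A i)) * real (card (T j)) / real (order R))"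
    by (simp add: sum_product sum_divide_distrib)
  then show ?thesis
    by (simp add: discrepancy_eq incidences_UN[OF assms] sum_subtractf)
qed

locale finite_block_system = finite_quadratic_space +
  fixes B :: "('a, 'c) block_data"
  assumes block: "block_system R M Q B"
begin

abbreviation v where "v \<equiv> iso_vec B"
abbreviation w where "w \<equiv> dual_vec B"
abbreviation X where "X \<equiv> base_section R M Q B"
abbreviation P where "P \<equiv> block_points R M Q B"
abbreviation T where "T \<equiv> block_spheres R M B"
abbreviation A where "A \<equiv> point_block R M Q B"
abbreviation \<S> where "\<S> \<equiv> sphere_block R M B"

lemma block_facts [simp]: "v \<in> carrier M" "v \<noteq> \<zero>\<^bsub>M\<^esub>" "Q v = \<zero>" "w \<in> carrier M"
    "ip w v = \<one>" "rad B \<in> carrier R" "rad B \<noteq> \<zero>"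
  and idx: "idx B \<subseteq> carrier R" "idx B \<noteq> {}" and rad: "rad B \<in> Q ` orth v"
  using block by (auto simp: block_system_def)

lemma ip_v_w [simp]: "ip v w = \<one>"
  using ip_commute[of v w] by simp

lemma ip_v_v [simp]: "ip v v = \<zero>"
  by (simp add: ip_self)

lemma finite_idx: "finite (idx B)"
  using idx(1) finite_scalars by (rule finite_subset)

lemma X_facts: "y \<in> X \<Longrightarrow> y \<in> carrier M" "y \<in> X \<Longrightarrow> ip y v = \<zero>" "y \<in> X \<Longrightarrow> Q y = rad B"
  by (auto simp: base_section_def perp_def)

lemma finite_X: "finite X"
  using finite_vectors by (rule finite_subset[rotated]) (auto simp: X_facts)

lemma card_X_pos: "card X > 0"
  using rad finite_X by (auto simp: card_gt_0_iff base_section_def)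

text \<open>With \<open>\<delta> = b - z\<close>, the form at point minus centre exceeds
  \<open>rad B\<close> by \<open>\<delta> (\<delta> Q w + 2 (<w,y> - u))\<close>. There is no term
  in \<open>u\<close> alone, since \<open>v\<close> is isotropic and orthogonal to \<open>y\<close>.
  So either \<open>\<delta>\<close> vanishes or \<open>u\<close> is determined after division by
  two.\<close>

lemma in_sphere_iff:
  assumes y: "y \<in> X" and bz: "b \<in> carrier R" "z \<in> carrier R" and u: "u \<in> carrier R"
  shows "b \<odot>\<^bsub>M\<^esub> w \<oplus>\<^bsub>M\<^esub> y \<in> qsphere M Q (z \<odot>\<^bsub>M\<^esub> w \<oplus>\<^bsub>M\<^esub> u \<odot>\<^bsub>M\<^esub> v, rad B) \<longleftrightarrow>
    b = z \<or> u = (b \<ominus> z) \<otimes> Q w \<otimes> inv (\<one> \<oplus> \<one>) \<oplus> ip w y"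
proof -
  have yM: "y \<in> carrier M" and yv: "ip y v = \<zero>" and Qy: "Q y = rad B"
    using X_facts y by auto
  define \<delta> where "\<delta> = b \<ominus> z"
  define h where "h = inv (\<one> \<oplus> \<one>)"
  have c: "\<delta> \<in> carrier R" "Q w \<in> carrier R" "ip w y \<in> carrier R" "h \<in> carrier R"
    using bz yM half_closed by (auto simp: \<delta>_def h_def)
  have "b \<odot>\<^bsub>M\<^esub> w \<oplus>\<^bsub>M\<^esub> y \<ominus>\<^bsub>M\<^esub> (z \<odot>\<^bsub>M\<^esub> w \<oplus>\<^bsub>M\<^esub> u \<odot>\<^bsub>M\<^esub> v) =
      \<delta> \<odot>\<^bsub>M\<^esub> w \<oplus>\<^bsub>M\<^esub> (y \<oplus>\<^bsub>M\<^esub> (\<ominus> u) \<odot>\<^bsub>M\<^esub> v)"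
    using bz u yM by (simp add: \<delta>_def a_minus_def smult_l_distr smult_l_minus M.minus_add M.a_ac)
  also have "Q \<dots> = \<delta> \<otimes> \<delta> \<otimes> Q w \<oplus> rad B \<oplus> (\<delta> \<otimes> (ip w y \<ominus> u) \<oplus> \<delta> \<otimes> (ip w y \<ominus> u))"
  proof -
    have "Q (y \<oplus>\<^bsub>M\<^esub> (\<ominus> u) \<odot>\<^bsub>M\<^esub> v) = rad B"
      using yM u yv Qy by (simp add: Q_line)
    moreover have "ip (\<delta> \<odot>\<^bsub>M\<^esub> w) (y \<oplus>\<^bsub>M\<^esub> (\<ominus> u) \<odot>\<^bsub>M\<^esub> v) = \<delta> \<otimes> (ip w y \<ominus> u)"
      using yM u c by (simp add: ip_add_right ip_smult_left ip_smult_right a_minus_def r_distr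
          R.r_minus l_minus m_comm)
    ultimately show ?thesis
      using c yM u by (simp add: Q_add Q_smult)
  qed
  also have "\<dots> = rad B \<oplus> \<delta> \<otimes> (\<delta> \<otimes> Q w \<oplus> ((ip w y \<ominus> u) \<oplus> (ip w y \<ominus> u)))"
  proof -
    have "\<delta> \<otimes> \<delta> \<otimes> a \<oplus> r \<oplus> (\<delta> \<otimes> (g \<ominus> u) \<oplus> \<delta> \<otimes> (g \<ominus> u)) = r \<oplus> \<delta> \<otimes> (\<delta> \<otimes> a \<oplus> ((g \<ominus> u) \<oplus> (g \<ominus> u)))"
      if "a \<in> carrier R" "r \<in> carrier R" "g \<in> carrier R" for a r g
      using that u c(1) by algebra
    then show ?thesis using c by simp
  qed
  finally have "Q (b \<odot>\<^bsub>M\<^esub> w \<oplus>\<^bsub>M\<^esub> y \<ominus>\<^bsub>M\<^esub> (z \<odot>\<^bsub>M\<^esub> w \<oplus>\<^bsub>M\<^esub> u \<odot>\<^bsub>M\<^esub> v)) = rad B \<longleftrightarrow>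
      \<delta> \<otimes> (\<delta> \<otimes> Q w \<oplus> ((ip w y \<ominus> u) \<oplus> (ip w y \<ominus> u))) = \<zero>"
    using c u by simp
  also have "\<dots> \<longleftrightarrow> b = z \<or> \<delta> \<otimes> Q w \<oplus> ((ip w y \<ominus> u) \<oplus> (ip w y \<ominus> u)) = \<zero>"
    using c u bz by (simp add: integral_iff \<delta>_def)
  also have "\<delta> \<otimes> Q w \<oplus> ((ip w y \<ominus> u) \<oplus> (ip w y \<ominus> u)) = \<zero> \<longleftrightarrow> u = \<delta> \<otimes> Q w \<otimes> h \<oplus> ip w y"
  proof -
    have hh: "(\<one> \<oplus> \<one>) \<otimes> h = \<one>" using half by (simp add: h_def)
    \<comment> \<open>Inserting \<open>(1 + 1) h = 1\<close> into the first summand makes the factor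
      two common to both, so that it can be cancelled.\<close>
    have "\<delta> \<otimes> Q w \<oplus> ((ip w y \<ominus> u) \<oplus> (ip w y \<ominus> u)) =
        \<delta> \<otimes> Q w \<otimes> ((\<one> \<oplus> \<one>) \<otimes> h) \<oplus> ((ip w y \<ominus> u) \<oplus> (ip w y \<ominus> u))"
      using hh c by simp
    also have "\<dots> = (\<one> \<oplus> \<one>) \<otimes> (\<delta> \<otimes> Q w \<otimes> h \<oplus> ip w y \<ominus> u)"
    proof -
      have "\<delta> \<otimes> a \<otimes> ((\<one> \<oplus> \<one>) \<otimes> h) \<oplus> ((g \<ominus> u) \<oplus> (g \<ominus> u)) = (\<one> \<oplus> \<one>) \<otimes> (\<delta> \<otimes> a \<otimes> h \<oplus> g \<ominus> u)"
        if "a \<in> carrier R" "g \<in> carrier R" for a g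
        using that u c(1,4) by algebra
      then show ?thesis using c by simp
    qed
    finally show ?thesis
      using c u two_nonzero by (simp add: integral_iff) (metis)
  qed
  finally show ?thesis
    using bz u yM by (simp add: qsphere_def \<delta>_def h_def)
qed

section \<open>Sizes, disjointness and discrepancies of the blocks\<close>

lemma smult_v_inj:
  assumes "a \<in> carrier R" "b \<in> carrier R" "a \<odot>\<^bsub>M\<^esub> v = b \<odot>\<^bsub>M\<^esub> v"
  shows "a = b"
proof -
  have "ip (a \<odot>\<^bsub>M\<^esub> v) w = ip (b \<odot>\<^bsub>M\<^esub> v) w" using assms by simp
  then show ?thesis using assms(1,2) by (simp add: ip_smult_left)
qed

lemma centre_inj:
  assumes "z \<in> carrier R"
  shows "inj_on (\<lambda>u. (z \<odot>\<^bsub>M\<^esub> w \<oplus>\<^bsub>M\<^esub> u \<odot>\<^bsub>M\<^esub> v, rad B)) (carrier R)"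
  using assms by (auto intro!: inj_onI smult_v_inj)

lemma card_sphere_block: "z \<in> carrier R \<Longrightarrow> card (\<S> z) = q"
  unfolding sphere_block_def order_def by (intro card_image centre_inj)

lemma finite_sphere_block: "finite (\<S> z)"
  unfolding sphere_block_def using finite_scalars by simp

lemma point_inj: "b \<in> carrier R \<Longrightarrow> inj_on (\<lambda>y. b \<odot>\<^bsub>M\<^esub> w \<oplus>\<^bsub>M\<^esub> y) X"
  by (auto intro!: inj_onI simp: X_facts)

lemma card_point_block: "b \<in> carrier R \<Longrightarrow> card (A b) = card X"
  unfolding point_block_def by (intro card_image point_inj)

lemma finite_point_block: "finite (A b)"
  unfolding point_block_def using finite_X by simp

text \<open>Pairing with \<open>v\<close> reads the block index off a point, as \<open>w\<close>
  contributes one and \<open>X\<close> contributes nothing; disjointness of the point blocks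
  follows.\<close>

lemma ip_point: "b \<in> carrier R \<Longrightarrow> p \<in> A b \<Longrightarrow> ip p v = b"
  by (auto simp: point_block_def X_facts ip_add_left ip_smult_left)

lemma disjoint_points: "disjoint_family_on A (idx B)"
proof -
  have "A b \<inter> A z = {}" if "b \<in> idx B" "z \<in> idx B" "b \<noteq> z" for b z
    using that ip_point[of b] ip_point[of z] idx by blast
  then show ?thesis by (auto simp: disjoint_family_on_def)
qed

text \<open>The index is read off the centre, where isotropy of \<open>v\<close> removes the part
  along \<open>v\<close>. Sphere blocks are sets of pairs, so distinct centres suffice for
  disjointness.\<close>

lemma ip_centre: "z \<in> carrier R \<Longrightarrow> S \<in> \<S> z \<Longrightarrow> ip (fst S) v = z"
  by (auto simp: sphere_block_def ip_add_left ip_smult_left)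

lemma disjoint_spheres: "disjoint_family_on \<S> (idx B)"
proof -
  have "\<S> b \<inter> \<S> z = {}" if "b \<in> idx B" "z \<in> idx B" "b \<noteq> z" for b z
    using that ip_centre[of b] ip_centre[of z] idx by blast
  then show ?thesis by (auto simp: disjoint_family_on_def)
qed

lemma card_points: "card P = card (idx B) * card X"
proof -
  have "card P = (\<Sum>b\<in>idx B. card (A b))"
    unfolding block_points_def using disjoint_points finite_idx finite_point_block
    by (intro card_UN_disjoint) (auto simp: disjoint_family_on_def)
  also have "\<dots> = (\<Sum>b\<in>idx B. card X)"
    using idx by (intro sum.cong refl card_point_block) auto
  finally show ?thesis by simp
qed

lemma card_spheres: "card T = card (idx B) * q"
proof -
  have "card T = (\<Sum>b\<in>idx B. card (\<S> b))"
    unfolding block_spheres_def using disjoint_spheres finite_idx finite_sphere_block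
    by (intro card_UN_disjoint) (auto simp: disjoint_family_on_def)
  also have "\<dots> = (\<Sum>b\<in>idx B. q)"
    using idx by (intro sum.cong refl card_sphere_block) auto
  finally show ?thesis by simp
qed

lemma incidences_blocks:
  assumes b: "b \<in> carrier R" and z: "z \<in> carrier R"
  shows "incidences M Q (A b) (\<S> z) = (if b = z then card X * q else card X)"
proof -
  have "card {S \<in> \<S> z. p \<in> qsphere M Q S} = (if b = z then q else 1)" if p: "p \<in> A b" for p
  proof -
    obtain y where y: "y \<in> X" "p = b \<odot>\<^bsub>M\<^esub> w \<oplus>\<^bsub>M\<^esub> y"
      using p by (auto simp: point_block_def)
    let ?c = "\<lambda>u. (z \<odot>\<^bsub>M\<^esub> w \<oplus>\<^bsub>M\<^esub> u \<odot>\<^bsub>M\<^esub> v, rad B)"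
    let ?u = "(b \<ominus> z) \<otimes> Q w \<otimes> inv (\<one> \<oplus> \<one>) \<oplus> ip w y"
    have uR: "?u \<in> carrier R" using b z y half_closed X_facts by auto
    have "{S \<in> \<S> z. p \<in> qsphere M Q S} = ?c ` {u \<in> carrier R. p \<in> qsphere M Q (?c u)}"
      by (auto simp: sphere_block_def)
    also have "{u \<in> carrier R. p \<in> qsphere M Q (?c u)} = (if b = z then carrier R else {?u})"
      using in_sphere_iff[OF y(1) b z] uR unfolding y(2) by auto
    finally show ?thesis
      using card_image[OF centre_inj[OF z]] by (simp add: order_def)
  qed
  then show ?thesis
    using b by (simp add: incidences_eq_sum finite_point_block finite_sphere_block card_point_block)
qed

text \<open>The expected count is \<open>card X\<close> for every pair of blocks, since a sphere
  block has exactly \<open>q\<close> members. One incidence per point meets it exactly;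
  \<open>q\<close> incidences per point exceed it by the factor \<open>q\<close>.\<close>

lemma discrepancy_blocks:
  assumes b: "b \<in> carrier R" and z: "z \<in> carrier R"
  shows "discrepancy R M Q (A b) (\<S> z) = (if b = z then real (card X) * (real q - 1) else 0)"
  using b z q_pos by (simp add: discrepancy_eq incidences_blocks card_point_block card_sphere_block algebra_simps)

lemma discrepancy_system:
  "discrepancy R M Q P T = (\<Sum>z\<in>idx B. discrepancy R M Q (A z) (\<S> z))"
proof -
  have "discrepancy R M Q P T = (\<Sum>b\<in>idx B. \<Sum>z\<in>idx B. discrepancy R M Q (A b) (\<S> z))"
    unfolding block_points_def block_spheres_def
    by (intro discrepancy_UN finite_idx disjoint_points disjoint_spheres finite_point_block finite_sphere_block)
  also have "\<dots> = (\<Sum>b\<in>idx B. \<Sum>z\<in>idx B. if b = z then real (card X) * (real q - 1) else 0)"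
    using idx by (intro sum.cong refl discrepancy_blocks) auto
  also have "\<dots> = (\<Sum>b\<in>idx B. discrepancy R M Q (A b) (\<S> b))"
    using finite_idx idx by (intro sum.cong refl) (auto simp: discrepancy_blocks)
  finally show ?thesis .
qed

lemma exact_blocks: "exact_centered_blocks R M Q B"
  unfolding exact_centered_blocks_def
  using disjoint_points disjoint_spheres discrepancy_system discrepancy_blocks
  by (auto simp: subsetD[OF idx(1)])

lemma discrepancy_total: "discrepancy R M Q P T = real (card (idx B)) * real (card X) * (real q - 1)"
proof -
  have "discrepancy R M Q P T = (\<Sum>z\<in>idx B. real (card X) * (real q - 1))"
    unfolding discrepancy_system using idx by (intro sum.cong refl) (auto simp: discrepancy_blocks)
  then show ?thesis by simp
qed

end

section \<open>Level sets, slices and the existence of block systems\<close>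

context finite_quadratic_space
begin

lemma card_orth_mult:
  assumes d: "d \<ge> 3" and v: "v \<in> carrier M" "v \<noteq> \<zero>\<^bsub>M\<^esub>"
  shows "card (orth v) = q * q ^ (d - 2)"
proof -
  have "d - 1 = Suc (d - 2)" using d by simp
  then show ?thesis using card_orth_gt(1)[OF d v] by simp
qed

text \<open>The value \<open>r\<close> is arbitrary: the zero level must be controlled as well,
  because the averaging argument has to discard it.\<close>

lemma card_level_le:
  assumes d: "d \<ge> 3" and v: "v \<in> carrier M" "v \<noteq> \<zero>\<^bsub>M\<^esub>"
  shows "card {y \<in> orth v. Q y = r} \<le> 2 * q ^ (d - 2)"
proof -
  obtain e where e: "e \<in> orth v" "Q e \<noteq> \<zero>"
    using exists_anisotropic[OF d v] .
  then have eM: "e \<in> carrier M" using orth_subset by blast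
  have closed: "x \<oplus>\<^bsub>M\<^esub> s \<odot>\<^bsub>M\<^esub> e \<in> orth v" if "x \<in> orth v" "s \<in> carrier R" for x s
    using that e submoduleE(4,5)[OF submodule_orth[OF v(1)]] by simp
  have "q * card {y \<in> orth v. Q y = r} \<le> 2 * card (orth v)"
  proof (rule line_count[OF orth_subset _ eM closed])
    fix x assume x: "x \<in> orth v"
    then have "{s \<in> carrier R. x \<oplus>\<^bsub>M\<^esub> s \<odot>\<^bsub>M\<^esub> e \<in> {y \<in> orth v. Q y = r}}
        = {s \<in> carrier R. Q (x \<oplus>\<^bsub>M\<^esub> s \<odot>\<^bsub>M\<^esub> e) = r}"
      using closed by auto
    then show "card {s \<in> carrier R. x \<oplus>\<^bsub>M\<^esub> s \<odot>\<^bsub>M\<^esub> e \<in> {y \<in> orth v. Q y = r}} \<le> 2"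
      using card_roots_le_2[of x e r] x orth_subset eM e by auto
  qed auto
  also note card_orth_mult[OF d v]
  finally show ?thesis
    using q_pos by simp
qed

text \<open>
  Averaging over the nonzero values of \<open>Q\<close> replaces the exact count of points on a quadric.
\<close>

lemma exists_large_level:
  assumes d: "d \<ge> 3" and v: "v \<in> carrier M" "v \<noteq> \<zero>\<^bsub>M\<^esub>"
  obtains r where "r \<in> carrier R" "r \<noteq> \<zero>" "q ^ (d - 2) \<le> 2 * card {y \<in> orth v. Q y = r}"
proof -
  let ?n = "\<lambda>r. card {y \<in> orth v. Q y = r}"
  define m where "m = q ^ (d - 2)"
  define k where "k = (q - 1) * m"
  have "\<exists>r\<in>carrier R - {\<zero>}. m \<le> 2 * ?n r"
  proof (rule ccontr)
    assume "\<not> ?thesis"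
    then have small: "2 * ?n r < m" if "r \<in> carrier R - {\<zero>}" for r
      using that by (meson not_le)
    have "orth v = (\<Union>r\<in>carrier R. {y \<in> orth v. Q y = r})"
      using orth_subset[of v] by auto
    then have "card (orth v) = card (\<Union>r\<in>carrier R. {y \<in> orth v. Q y = r})"
      by (rule arg_cong)
    also have "\<dots> = (\<Sum>r\<in>carrier R. ?n r)"
      using finite_orth finite_scalars by (intro card_UN_disjoint) auto
    also have "\<dots> = ?n \<zero> + (\<Sum>r\<in>carrier R - {\<zero>}. ?n r)"
      by (rule sum.remove[OF finite_scalars R.zero_closed])
    finally have "2 * card (orth v) = 2 * (?n \<zero> + (\<Sum>r\<in>carrier R - {\<zero>}. ?n r))"
      by (rule arg_cong)
    also have "\<dots> = 2 * ?n \<zero> + (\<Sum>r\<in>carrier R - {\<zero>}. 2 * ?n r)"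
      by (simp only: distrib_left sum_distrib_left)
    finally have "2 * card (orth v) = 2 * ?n \<zero> + (\<Sum>r\<in>carrier R - {\<zero>}. 2 * ?n r)" .
    moreover have "(\<Sum>r\<in>carrier R - {\<zero>}. 2 * ?n r) < (\<Sum>r\<in>carrier R - {\<zero>}. m)"
    proof (rule sum_strict_mono)
      show "carrier R - {\<zero>} \<noteq> {}"
      proof
        assume "carrier R - {\<zero>} = {}"
        then have "\<one> \<in> {\<zero>}" using R.one_closed by (metis DiffI empty_iff)
        then show False by simp
      qed
      show "finite (carrier R - {\<zero>})" using finite_scalars by simp
    qed (rule small)
    moreover have "(\<Sum>r\<in>carrier R - {\<zero>}. m) = k"
      using finite_scalars by (simp add: order_def k_def)
    moreover have "?n \<zero> \<le> 2 * m"
      unfolding m_def by (rule card_level_le[OF d v])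
    moreover have "card (orth v) = k + m"
      unfolding card_orth_mult[OF d v] m_def[symmetric] k_def
      using q_pos by (cases "order R") auto
    \<comment> \<open>Here \<open>q \<ge> 3\<close> enters. The other facts give
      \<open>2 k + 2 m < 4 m + k\<close>, that is \<open>k < 2 m\<close>.\<close>
    moreover have "2 * m \<le> k"
      unfolding k_def using q_ge_3 by (intro mult_right_mono) auto
    ultimately show False by linarith
  qed
  then obtain r where "r \<in> carrier R" "r \<noteq> \<zero>" "m \<le> 2 * ?n r" by blast
  then show thesis unfolding m_def by (rule that)
qed

text \<open>
  Some direction \<open>e\<close> of the slice makes \<open>Q\<close> nonconstant on all its lines. Otherwise the direction
  space \<open>V0\<close> of the slice would be totally singular and orthogonal to a point \<open>h\<close> of the level set,
  hence to all of \<open>orth v\<close>, so that \<open>card V0 \<le> q\<close>.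
\<close>

lemma card_slice_le:
  assumes d: "d \<ge> 4" and v: "v \<in> carrier M" "v \<noteq> \<zero>\<^bsub>M\<^esub>"
    and f: "linear_functional f" and e0: "e0 \<in> orth v" "f e0 \<noteq> \<zero>"
    and r: "r \<noteq> \<zero>" and c: "c \<in> carrier R"
  shows "q * card {y \<in> orth v. Q y = r \<and> f y = c} \<le> 2 * q ^ (d - 2)"
proof -
  note V = submodule_orth[OF v(1)] and F = linear_functionalD[OF f]
  define V0 where "V0 = {x \<in> orth v. f x = \<zero>}"
  define S where "S = {x \<in> orth v. f x = c}"
  define L where "L = {y \<in> orth v. Q y = r \<and> f y = c}"
  have V0: "submodule V0 R M" unfolding V0_def by (rule submodule_kernel[OF V f])
  have V0_sub: "V0 \<subseteq> carrier M" and S_sub: "S \<subseteq> carrier M" and LS: "L \<subseteq> S"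
    using orth_subset by (auto simp: V0_def S_def L_def)
  have "q * card V0 = card (orth v)"
    unfolding V0_def by (rule card_kernel[OF V f e0, symmetric])
  then have cV0: "card V0 = q ^ (d - 2)"
    using card_orth_mult[OF _ v] d q_pos by simp
  have cS: "card S = q ^ (d - 2)"
    using card_fibre[OF V f e0 c] cV0 by (simp add: V0_def S_def)
  have closed: "x \<oplus>\<^bsub>M\<^esub> s \<odot>\<^bsub>M\<^esub> e \<in> S" if "x \<in> S" "s \<in> carrier R" "e \<in> V0" for x s e
  proof -
    have "x \<in> carrier M" "e \<in> carrier M" using that S_sub V0_sub by auto
    then show ?thesis
      using that submoduleE(4,5)[OF V] c by (auto simp: S_def V0_def F)
  qed
  \<comment> \<open>What remains is to find a direction in \<open>V0\<close> on whose lines the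
    value \<open>r\<close> is taken at most twice.\<close>
  have count: "q * card L \<le> 2 * q ^ (d - 2)"
    if e: "e \<in> V0" and le: "\<And>x. x \<in> S \<Longrightarrow> card {s \<in> carrier R. Q (x \<oplus>\<^bsub>M\<^esub> s \<odot>\<^bsub>M\<^esub> e) = r} \<le> 2" for e
  proof -
    have "q * card L \<le> 2 * card S"
    proof (rule line_count[OF S_sub LS])
      show "e \<in> carrier M" using e V0_sub by auto
      fix x assume x: "x \<in> S"
      then have "{s \<in> carrier R. x \<oplus>\<^bsub>M\<^esub> s \<odot>\<^bsub>M\<^esub> e \<in> L} \<subseteq> {s \<in> carrier R. Q (x \<oplus>\<^bsub>M\<^esub> s \<odot>\<^bsub>M\<^esub> e) = r}"
        by (auto simp: L_def)
      then have "card {s \<in> carrier R. x \<oplus>\<^bsub>M\<^esub> s \<odot>\<^bsub>M\<^esub> e \<in> L} \<le> card {s \<in> carrier R. Q (x \<oplus>\<^bsub>M\<^esub> s \<odot>\<^bsub>M\<^esub> e) = r}"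
        using finite_scalars by (intro card_mono) auto
      then show "card {s \<in> carrier R. x \<oplus>\<^bsub>M\<^esub> s \<odot>\<^bsub>M\<^esub> e \<in> L} \<le> 2"
        using le[OF x] by simp
    qed (rule closed[OF _ _ e])
    then show ?thesis using cS by simp
  qed
  have "q * card L \<le> 2 * q ^ (d - 2)"
  proof (cases "L = {}")
    case False
    then obtain h where h: "h \<in> orth v" "Q h = r" "f h = c" by (auto simp: L_def)
    then have hM: "h \<in> carrier M" using orth_subset by blast
    show ?thesis
    proof (cases "\<exists>e\<in>V0. Q e \<noteq> \<zero>")
      case True
      then obtain e where e: "e \<in> V0" "Q e \<noteq> \<zero>" by blast
      show ?thesis
        using e S_sub V0_sub by (intro count[OF e(1)] card_roots_le_2) auto
    next
      case False
      then have sing: "ip x y = \<zero>" if "x \<in> V0" "y \<in> V0" for x y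
        using ip_zero_of_singular[OF V0] that by blast
      have "\<exists>e\<in>V0. ip h e \<noteq> \<zero>"
      proof (rule ccontr)
        assume "\<not> ?thesis"
        then have h0: "ip h e = \<zero>" if "e \<in> V0" for e using that by blast
        \<comment> \<open>\<open>Q\<close> vanishes on \<open>V0\<close> but not at
          \<open>h\<close>, so \<open>f h\<close> is invertible. Subtracting a suitable multiple of
          \<open>h\<close> then moves any \<open>y\<close> of \<open>orth v\<close> into
          \<open>V0\<close>, and orthogonality of \<open>V0\<close> to itself and to
          \<open>h\<close> spreads to \<open>orth v\<close>.\<close>
        have "h \<notin> V0" using False h r by auto
        then have fh: "f h \<in> Units R" using h F(1)[OF hM] by (auto simp: V0_def field_Units)
        have "ip x y = \<zero>" if x: "x \<in> V0" and y: "y \<in> orth v" for x y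
        proof -
          have xM: "x \<in> carrier M" and yM: "y \<in> carrier M"
            using x y V0_sub orth_subset by auto
          define a where "a = f y \<otimes> inv (f h)"
          have a: "a \<in> carrier R" using F(1)[OF yM] fh by (auto simp: a_def)
          have "a \<otimes> f h = f y"
            using F(1)[OF yM] F(1)[OF hM] fh by (simp add: a_def R.m_assoc)
          then have "y \<ominus>\<^bsub>M\<^esub> a \<odot>\<^bsub>M\<^esub> h \<in> V0"
            using submodule_minus[OF V y submoduleE(4)[OF V a h(1)]] a hM yM F(1)[OF yM]
            by (simp add: V0_def F(3,4))
          then have "ip (y \<ominus>\<^bsub>M\<^esub> a \<odot>\<^bsub>M\<^esub> h) x = \<zero>" using sing x by simp
          then have "ip y x \<ominus> a \<otimes> ip h x = \<zero>"
            using xM yM hM a by (simp add: ip_minus_left ip_smult_left)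
          then show ?thesis using h0[OF x] a xM yM by (simp add: ip_commute[of x y] a_minus_def)
        qed
        then have "card V0 \<le> q"
          by (intro card_orth_orth[OF v V0_sub])
        \<comment> \<open>This strict inequality needs \<open>d \<ge> 4\<close>. For
          \<open>d = 3\<close> the space \<open>V0\<close> can be the line of \<open>v\<close>, and
          the slice can then be an entire line.\<close>
        moreover have "q ^ 1 < q ^ (d - 2)"
          using d q_ge_3 by (intro power_strict_increasing) auto
        ultimately show False using cV0 by simp
      qed
      then obtain e where e: "e \<in> V0" "ip h e \<noteq> \<zero>" by blast
      have eM: "e \<in> carrier M" using e V0_sub by auto
      show ?thesis
      proof (rule count[OF e(1)])
        fix x assume x: "x \<in> S"
        then have xM: "x \<in> carrier M" using S_sub by auto
        \<comment> \<open>Points of the slice differ by elements of \<open>V0\<close>, so they all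
          have the same nonzero pairing with \<open>e\<close>. Along each line \<open>Q\<close> is
          then affine with nonzero slope and takes the value \<open>r\<close> at most once.\<close>
        have "x \<ominus>\<^bsub>M\<^esub> h \<in> V0"
          using x h hM xM c submodule_minus[OF V] by (auto simp: V0_def S_def F(4))
        then have "ip x e \<ominus> ip h e = \<zero>"
          using sing e xM hM eM by (simp flip: ip_minus_left)
        then have xe: "ip x e \<noteq> \<zero>" "ip x e \<in> carrier R" using e xM hM eM by auto
        then have g: "ip x e \<oplus> ip x e \<noteq> \<zero>" using double_cancel by blast
        have "s = u" if s: "s \<in> carrier R" "Q (x \<oplus>\<^bsub>M\<^esub> s \<odot>\<^bsub>M\<^esub> e) = r"
          and u: "u \<in> carrier R" "Q (x \<oplus>\<^bsub>M\<^esub> u \<odot>\<^bsub>M\<^esub> e) = r" for s u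
        proof -
          have "Q x \<oplus> s \<otimes> (ip x e \<oplus> ip x e) = Q x \<oplus> u \<otimes> (ip x e \<oplus> ip x e)"
            using s u xM eM e False by (auto simp: Q_line)
          then show ?thesis using s u xM eM g xe by (simp add: m_rcancel)
        qed
        then have "\<exists>s. {s \<in> carrier R. Q (x \<oplus>\<^bsub>M\<^esub> s \<odot>\<^bsub>M\<^esub> e) = r} \<subseteq> {s}" by blast
        then obtain s where "{s \<in> carrier R. Q (x \<oplus>\<^bsub>M\<^esub> s \<odot>\<^bsub>M\<^esub> e) = r} \<subseteq> {s}" ..
        then have "card {s \<in> carrier R. Q (x \<oplus>\<^bsub>M\<^esub> s \<odot>\<^bsub>M\<^esub> e) = r} \<le> card {s}" by (intro card_mono) auto
        then show "card {s \<in> carrier R. Q (x \<oplus>\<^bsub>M\<^esub> s \<odot>\<^bsub>M\<^esub> e) = r} \<le> 2" by simp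
      qed
    qed
  qed simp
  then show ?thesis by (simp add: L_def)
qed

text \<open>Finiteness gives a maximal proper submodule \<open>W\<close> above \<open>U\<close>. For
  \<open>x\<close> outside \<open>W\<close>, maximality makes \<open>W\<close> and \<open>x\<close>
  together span everything, and \<open>f\<close> is the coefficient of \<open>x\<close> modulo
  \<open>W\<close>. This replaces extending a basis.\<close>

lemma exists_annihilating_functional:
  assumes U: "submodule U R M" "U \<noteq> carrier M"
  obtains f where "linear_functional f" "\<exists>x\<in>carrier M. f x \<noteq> \<zero>" "\<And>x. x \<in> U \<Longrightarrow> f x = \<zero>"
proof -
  define \<U> where "\<U> = {W. submodule W R M \<and> W \<noteq> carrier M \<and> U \<subseteq> W}"
  have "\<U> \<subseteq> Pow (carrier M)" using submoduleE(1) by (auto simp: \<U>_def)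
  then have "finite \<U>" using finite_vectors by (simp add: finite_subset)
  moreover have "U \<in> \<U>" using U by (simp add: \<U>_def)
  ultimately obtain W where W: "W \<in> \<U>" and max: "\<And>W'. W' \<in> \<U> \<Longrightarrow> W \<subseteq> W' \<Longrightarrow> W' = W"
    using finite_has_maximal2[of \<U> U] by metis
  have WM: "submodule W R M" "W \<noteq> carrier M" "U \<subseteq> W" "W \<subseteq> carrier M"
    using W submoduleE(1) by (auto simp: \<U>_def)
  note E = submoduleE[OF WM(1)]
  obtain x where x: "x \<in> carrier M" "x \<notin> W" using WM by auto
  have m0: "\<ominus>\<^bsub>M\<^esub> \<zero>\<^bsub>M\<^esub> = \<zero>\<^bsub>M\<^esub>"
    using M.minus_equality[of "\<zero>\<^bsub>M\<^esub>" "\<zero>\<^bsub>M\<^esub>"] by simp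
  define W' where "W' = {y \<in> carrier M. \<exists>a\<in>carrier R. y \<ominus>\<^bsub>M\<^esub> a \<odot>\<^bsub>M\<^esub> x \<in> W}"
  have add: "(y \<oplus>\<^bsub>M\<^esub> z) \<ominus>\<^bsub>M\<^esub> (a \<oplus> b) \<odot>\<^bsub>M\<^esub> x \<in> W"
    if "y \<in> carrier M" "z \<in> carrier M" "a \<in> carrier R" "b \<in> carrier R"
      "y \<ominus>\<^bsub>M\<^esub> a \<odot>\<^bsub>M\<^esub> x \<in> W" "z \<ominus>\<^bsub>M\<^esub> b \<odot>\<^bsub>M\<^esub> x \<in> W" for y z a b
  proof -
    have "(y \<oplus>\<^bsub>M\<^esub> z) \<ominus>\<^bsub>M\<^esub> (a \<oplus> b) \<odot>\<^bsub>M\<^esub> x = (y \<ominus>\<^bsub>M\<^esub> a \<odot>\<^bsub>M\<^esub> x) \<oplus>\<^bsub>M\<^esub> (z \<ominus>\<^bsub>M\<^esub> b \<odot>\<^bsub>M\<^esub> x)"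
      using that x by (simp add: a_minus_def smult_l_distr M.minus_add M.a_ac)
    then show ?thesis using that E(5) by simp
  qed
  have smult: "c \<odot>\<^bsub>M\<^esub> y \<ominus>\<^bsub>M\<^esub> (c \<otimes> a) \<odot>\<^bsub>M\<^esub> x \<in> W"
    if "y \<in> carrier M" "a \<in> carrier R" "c \<in> carrier R" "y \<ominus>\<^bsub>M\<^esub> a \<odot>\<^bsub>M\<^esub> x \<in> W" for y a c
  proof -
    have "c \<odot>\<^bsub>M\<^esub> y \<ominus>\<^bsub>M\<^esub> (c \<otimes> a) \<odot>\<^bsub>M\<^esub> x = c \<odot>\<^bsub>M\<^esub> (y \<ominus>\<^bsub>M\<^esub> a \<odot>\<^bsub>M\<^esub> x)"
      using that x by (simp add: a_minus_def smult_r_distr smult_r_minus smult_assoc1)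
    then show ?thesis using that E(4) by simp
  qed
  have sub: "W \<subseteq> W'"
  proof
    fix y assume "y \<in> W"
    then have "y \<in> carrier M" "y \<ominus>\<^bsub>M\<^esub> \<zero> \<odot>\<^bsub>M\<^esub> x \<in> W"
      using WM(4) x by (auto simp: a_minus_def m0)
    then show "y \<in> W'" by (auto simp: W'_def)
  qed
  have xW': "x \<in> W'"
    using x zero_in_submodule[OF WM(1)] by (auto simp: W'_def a_minus_def M.r_neg intro!: bexI[of _ \<one>])
  have sW': "submodule W' R M"
  proof (rule submoduleI)
    show "W' \<subseteq> carrier M" by (auto simp: W'_def)
    show "\<zero>\<^bsub>M\<^esub> \<in> W'" using zero_in_submodule[OF WM(1)] sub by blast
    show s: "c \<odot>\<^bsub>M\<^esub> y \<in> W'" if "c \<in> carrier R" "y \<in> W'" for c y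
      using that smult by (force simp: W'_def)
    show "\<ominus>\<^bsub>M\<^esub> y \<in> W'" if y: "y \<in> W'" for y
      using s[of "\<ominus> \<one>" y] y by (auto simp: W'_def smult_l_minus)
    show "y \<oplus>\<^bsub>M\<^esub> z \<in> W'" if "y \<in> W'" "z \<in> W'" for y z
      using that add by (force simp: W'_def)
  qed
  have "W' = carrier M"
    using max[of W'] sW' sub xW' x WM(3) by (auto simp: \<U>_def)
  then have ex: "\<exists>a\<in>carrier R. y \<ominus>\<^bsub>M\<^esub> a \<odot>\<^bsub>M\<^esub> x \<in> W" if "y \<in> carrier M" for y
    using that by (auto simp: W'_def)
  \<comment> \<open>Two different coefficients would put a nonzero multiple of \<open>x\<close>,
    hence \<open>x\<close> itself, into \<open>W\<close>.\<close>
  have uniq: "a = b" if ab: "a \<in> carrier R" "b \<in> carrier R" and y: "y \<in> carrier M"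
    "y \<ominus>\<^bsub>M\<^esub> a \<odot>\<^bsub>M\<^esub> x \<in> W" "y \<ominus>\<^bsub>M\<^esub> b \<odot>\<^bsub>M\<^esub> x \<in> W" for a b y
  proof (rule ccontr)
    assume "a \<noteq> b"
    then have u: "a \<ominus> b \<in> Units R" using ab by (simp add: field_Units)
    have "(y \<ominus>\<^bsub>M\<^esub> b \<odot>\<^bsub>M\<^esub> x) \<ominus>\<^bsub>M\<^esub> (y \<ominus>\<^bsub>M\<^esub> a \<odot>\<^bsub>M\<^esub> x) = (a \<ominus> b) \<odot>\<^bsub>M\<^esub> x"
    proof -
      have "\<ominus>\<^bsub>M\<^esub> (b \<odot>\<^bsub>M\<^esub> x) \<oplus>\<^bsub>M\<^esub> a \<odot>\<^bsub>M\<^esub> x = (a \<ominus> b) \<odot>\<^bsub>M\<^esub> x"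
        using ab x by (simp add: a_minus_def smult_l_distr smult_l_minus M.a_comm)
      moreover have "(y \<ominus>\<^bsub>M\<^esub> b \<odot>\<^bsub>M\<^esub> x) \<ominus>\<^bsub>M\<^esub> (y \<ominus>\<^bsub>M\<^esub> a \<odot>\<^bsub>M\<^esub> x) = y \<oplus>\<^bsub>M\<^esub> (\<ominus>\<^bsub>M\<^esub> y \<oplus>\<^bsub>M\<^esub> (\<ominus>\<^bsub>M\<^esub> (b \<odot>\<^bsub>M\<^esub> x) \<oplus>\<^bsub>M\<^esub> a \<odot>\<^bsub>M\<^esub> x))"
        using ab x y(1) by (simp add: a_minus_def M.minus_add M.a_ac)
      ultimately show ?thesis using ab x y(1) by (simp add: M.r_neg2)
    qed
    then have "(a \<ominus> b) \<odot>\<^bsub>M\<^esub> x \<in> W"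
      using submodule_minus[OF WM(1) y(3,2)] by simp
    then have "inv (a \<ominus> b) \<odot>\<^bsub>M\<^esub> ((a \<ominus> b) \<odot>\<^bsub>M\<^esub> x) \<in> W" using u E(4) by simp
    moreover have "inv (a \<ominus> b) \<odot>\<^bsub>M\<^esub> ((a \<ominus> b) \<odot>\<^bsub>M\<^esub> x) = x"
      using u ab x by (simp flip: smult_assoc1)
    ultimately show False using x by simp
  qed
  define f where "f y = (SOME a. a \<in> carrier R \<and> y \<ominus>\<^bsub>M\<^esub> a \<odot>\<^bsub>M\<^esub> x \<in> W)" for y
  have f: "f y \<in> carrier R" "y \<ominus>\<^bsub>M\<^esub> f y \<odot>\<^bsub>M\<^esub> x \<in> W" if "y \<in> carrier M" for y
    using someI_ex[of "\<lambda>a. a \<in> carrier R \<and> y \<ominus>\<^bsub>M\<^esub> a \<odot>\<^bsub>M\<^esub> x \<in> W"] ex[OF that] by (auto simp: f_def)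
  have feq: "f y = a" if "y \<in> carrier M" "a \<in> carrier R" "y \<ominus>\<^bsub>M\<^esub> a \<odot>\<^bsub>M\<^esub> x \<in> W" for y a
    using uniq[OF f(1)[OF that(1)] that(2,1) f(2)[OF that(1)] that(3)] .
  show thesis
  proof (rule that)
    show "linear_functional f"
      unfolding linear_functional_def
      by (auto intro!: feq f add smult)
    show "\<exists>y\<in>carrier M. f y \<noteq> \<zero>"
    proof
      have "f x = \<one>"
        using x zero_in_submodule[OF WM(1)] by (intro feq) (auto simp: a_minus_def M.r_neg)
      then show "f x \<noteq> \<zero>" by simp
    qed (rule x)
    fix y assume "y \<in> U"
    then have "y \<in> W" "y \<in> carrier M" using WM by auto
    then show "f y = \<zero>"
      using x by (intro feq) (auto simp: a_minus_def m0)
  qed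
qed

section \<open>Existence of block systems of prescribed size\<close>

lemma exists_block_system:
  assumes v: "v \<in> carrier M" "v \<noteq> \<zero>\<^bsub>M\<^esub>" "Q v = \<zero>"
    and r: "r \<in> carrier R" "r \<noteq> \<zero>" "r \<in> Q ` orth v" and t: "0 < t" "t \<le> q"
  obtains B :: "('a, 'c) block_data" where "block_system R M Q B" "card (idx B) = t"
    "base_section R M Q B = {y \<in> orth v. Q y = r}"
proof -
  obtain w where w: "w \<in> carrier M" "ip w v = \<one>"
    using exists_dual v by blast
  obtain Z where Z: "Z \<subseteq> carrier R" "card Z = t"
    using t(2) unfolding order_def by (meson obtain_subset_with_card_n)
  let ?B = "\<lparr>iso_vec = v, dual_vec = w, rad = r, idx = Z\<rparr>"
  show thesis
  proof (rule that)
    show "block_system R M Q ?B"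
      using v w r Z t(1) by (auto simp: block_system_def)
  qed (use Z in \<open>auto simp: base_section_def\<close>)
qed

lemma exists_wide_block_system:
  assumes d: "d \<ge> 3" and t: "0 < t" "t \<le> q"
  obtains B :: "('a, 'c) block_data" where "block_system R M Q B" "card (idx B) = t"
    "q ^ (d - 2) \<le> 2 * card (base_section R M Q B)"
    "card (base_section R M Q B) \<le> 2 * q ^ (d - 2)"
proof -
  obtain v where v: "v \<in> carrier M" "v \<noteq> \<zero>\<^bsub>M\<^esub>" "Q v = \<zero>"
    using exists_isotropic[OF d] .
  obtain r where r: "r \<in> carrier R" "r \<noteq> \<zero>" "q ^ (d - 2) \<le> 2 * card {y \<in> orth v. Q y = r}"
    using exists_large_level[OF d v(1,2)] .
  have "q ^ (d - 2) > 0" using q_pos by simp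
  then have "card {y \<in> orth v. Q y = r} > 0" using r(3) by linarith
  then have "{y \<in> orth v. Q y = r} \<noteq> {}" by (metis card_gt_0_iff)
  then have "r \<in> Q ` orth v" by blast
  then obtain B :: "('a, 'c) block_data" where "block_system R M Q B" "card (idx B) = t"
    "base_section R M Q B = {y \<in> orth v. Q y = r}"
    using exists_block_system[OF v r(1,2) _ t] by blast
  then show thesis
    using that[of B] r(3) card_level_le[OF d v(1,2), of r] by simp
qed

text \<open>With the value \<open>Q e\<close> of an anisotropic \<open>e\<close> in
  \<open>orth v\<close> as radius, both lines \<open>e + a v\<close> and \<open>-e + a v\<close> lie
  in the level set. Their \<open>2 q\<close> points already reach the upper bound of
  \<open>card_level_le\<close> for \<open>d = 3\<close>, so the count is exact.\<close>

lemma exists_ternary_block_system: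
  assumes d: "d = 3" and t: "0 < t" "t \<le> q"
  obtains B :: "('a, 'c) block_data" where "block_system R M Q B" "card (idx B) = t"
    "card (base_section R M Q B) = 2 * q"
proof -
  have d3: "d \<ge> 3" using d by simp
  obtain v where v: "v \<in> carrier M" "v \<noteq> \<zero>\<^bsub>M\<^esub>" "Q v = \<zero>"
    using exists_isotropic[OF d3] .
  obtain e where e: "e \<in> orth v" "Q e \<noteq> \<zero>"
    using exists_anisotropic[OF d3 v(1,2)] .
  then have eM: "e \<in> carrier M" "ip e v = \<zero>" by (auto simp: perp_def)
  obtain B :: "('a, 'c) block_data" where B: "block_system R M Q B" "card (idx B) = t"
    "base_section R M Q B = {y \<in> orth v. Q y = Q e}"
    using exists_block_system[OF v, of "Q e"] e eM t by blast
  let ?p = "\<lambda>a. e \<oplus>\<^bsub>M\<^esub> a \<odot>\<^bsub>M\<^esub> v" and ?m = "\<lambda>a. \<ominus>\<^bsub>M\<^esub> e \<oplus>\<^bsub>M\<^esub> a \<odot>\<^bsub>M\<^esub> v"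
  obtain w where w: "w \<in> carrier M" "ip w v = \<one>"
    using exists_dual v by blast
  have inj: "a = b" if "a \<in> carrier R" "b \<in> carrier R" "a \<odot>\<^bsub>M\<^esub> v = b \<odot>\<^bsub>M\<^esub> v" for a b
  proof -
    have "ip (a \<odot>\<^bsub>M\<^esub> v) w = ip (b \<odot>\<^bsub>M\<^esub> v) w" using that by simp
    then show ?thesis using that(1,2) v w by (simp add: ip_smult_left ip_commute[of v w])
  qed
  have "inj_on ?p (carrier R)" "inj_on ?m (carrier R)"
    using eM v inj by (auto intro!: inj_onI)
  then have cards: "card (?p ` carrier R) = q" "card (?m ` carrier R) = q"
    by (simp_all add: card_image order_def)
  \<comment> \<open>Pairing with \<open>e\<close> is constantly \<open>Q e\<close> on one line and
    \<open>- Q e\<close> on the other; these differ in odd characteristic.\<close>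
  have "?p ` carrier R \<inter> ?m ` carrier R = {}"
  proof (rule ccontr)
    assume "\<not> ?thesis"
    then obtain a b where ab: "a \<in> carrier R" "b \<in> carrier R" "?p a = ?m b" by blast
    have "ip (?p a) e = Q e" "ip (?m b) e = \<ominus> Q e"
      using ab(1,2) eM v by (simp_all add: ip_add_left ip_smult_left ip_uminus_left ip_self ip_commute[of v e])
    then have "Q e = \<ominus> Q e" using ab(3) by simp
    then have "Q e \<oplus> Q e = \<zero>" using eM Q_closed[of e] R.r_neg[of "Q e"] by simp
    then show False using double_cancel e eM by blast
  qed
  then have "card (?p ` carrier R \<union> ?m ` carrier R) = 2 * q"
    using cards finite_scalars by (subst card_Un_disjoint) auto
  moreover have "?p ` carrier R \<union> ?m ` carrier R \<subseteq> base_section R M Q B"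
  proof -
    have "Q (\<ominus>\<^bsub>M\<^esub> e) = Q e"
      using eM Q_smult[of "\<ominus> \<one>" e] by (simp add: smult_l_minus R.r_minus l_minus)
    then show ?thesis
      using eM v by (auto simp: B(3) perp_def Q_line ip_add_left ip_smult_left ip_uminus_left ip_self)
  qed
  moreover have fin: "finite (base_section R M Q B)"
    using finite_orth[of v] by (simp add: B(3))
  ultimately have "2 * q \<le> card (base_section R M Q B)"
    using card_mono by metis
  moreover have "card (base_section R M Q B) \<le> 2 * q"
    using card_level_le[OF d3 v(1,2), of "Q e"] by (simp add: B(3) d)
  ultimately show thesis using that[OF B(1,2)] by simp
qed

text \<open>Reduces proper flats of every dimension to level sets of one functional, so the estimate
  for hyperplanes also serves for flats.\<close>

lemma affine_flat_functional:
  assumes "affine_flat R M L" "L \<noteq> carrier M"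
  obtains f c where "linear_functional f" "\<exists>x\<in>carrier M. f x \<noteq> \<zero>" "c \<in> carrier R" "\<And>x. x \<in> L \<Longrightarrow> f x = c"
proof -
  obtain p U where pU: "p \<in> carrier M" "submodule U R M" "L = (\<lambda>x. p \<oplus>\<^bsub>M\<^esub> x) ` U"
    using assms(1) by (auto simp: affine_flat_def)
  note E = submoduleE[OF pU(2)]
  have "U \<noteq> carrier M"
  proof
    assume U: "U = carrier M"
    have "carrier M \<subseteq> L"
    proof
      fix x assume x: "x \<in> carrier M"
      then have "x = p \<oplus>\<^bsub>M\<^esub> (x \<ominus>\<^bsub>M\<^esub> p)"
        using pU(1) M.a_lcomm[of p x "\<ominus>\<^bsub>M\<^esub> p"] by (simp add: a_minus_def M.r_neg)
      then show "x \<in> L" unfolding pU(3) U by (rule image_eqI) (use x pU(1) in simp)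
    qed
    then show False using assms(2) pU E(1) by auto
  qed
  then obtain f where f: "linear_functional f" "\<exists>x\<in>carrier M. f x \<noteq> \<zero>" "\<And>x. x \<in> U \<Longrightarrow> f x = \<zero>"
    using exists_annihilating_functional[OF pU(2)] by blast
  note F = linear_functionalD[OF f(1)]
  have "f x = f p" if "x \<in> L" for x
    using that pU(1) E(1) f(3) by (auto simp: pU(3) F(1,2) subset_iff)
  then show thesis using that f(1,2) F(1)[OF pU(1)] by blast
qed

text \<open>Properness holds because the direction space misses every anisotropic vector
  \<open>e\<close>, so that \<open>p + e\<close> lies outside the flat.\<close>

lemma singular_flat:
  assumes L: "totally_singular_flat R M Q L" and d: "d \<ge> 3"
  shows "affine_flat R M L" "L \<noteq> carrier M"
proof -
  obtain p U where pU: "p \<in> carrier M" "submodule U R M" "\<And>x. x \<in> U \<Longrightarrow> Q x = \<zero>" "L = (\<lambda>x. p \<oplus>\<^bsub>M\<^esub> x) ` U"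
    using L by (auto simp: totally_singular_flat_def)
  then show "affine_flat R M L" by (auto simp: affine_flat_def)
  obtain v where v: "v \<in> carrier M" "v \<noteq> \<zero>\<^bsub>M\<^esub>" "Q v = \<zero>"
    using exists_isotropic[OF d] .
  obtain e where "e \<in> orth v" "Q e \<noteq> \<zero>"
    using exists_anisotropic[OF d v(1,2)] .
  then have e: "e \<in> carrier M" "e \<notin> U" using pU(3) by (auto simp: perp_def)
  show "L \<noteq> carrier M"
  proof
    assume "L = carrier M"
    then have "p \<oplus>\<^bsub>M\<^esub> e \<in> (\<lambda>x. p \<oplus>\<^bsub>M\<^esub> x) ` U" using pU(1,4) e by simp
    then obtain x where x: "x \<in> U" "p \<oplus>\<^bsub>M\<^esub> e = p \<oplus>\<^bsub>M\<^esub> x" by blast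
    then have "e = x" using pU(1) e submoduleE(1)[OF pU(2)] by auto
    then show False using x e by simp
  qed
qed

end

section \<open>Concentration of the point set on hyperplanes and flats\<close>

context finite_block_system
begin

lemma card_points_slice:
  assumes d: "d \<ge> 4" and wide: "q ^ (d - 2) \<le> 2 * card X"
    and f: "linear_functional f" "\<exists>x\<in>carrier M. f x \<noteq> \<zero>" and c: "c \<in> carrier R"
  shows "real (card {p \<in> P. f p = c}) \<le> (4 / real q + 1 / real (card (idx B))) * real (card P)"
proof -
  note F = linear_functionalD[OF f(1)]
  have t: "card (idx B) > 0" using idx finite_idx by (simp add: card_gt_0_iff)
  have eq: "{p \<in> P. f p = c} = (\<Union>z\<in>idx B. {p \<in> A z. f p = c})"
    by (auto simp: block_points_def)
  have Aeq: "f p = z \<otimes> f w \<oplus> f y" if "z \<in> carrier R" "y \<in> X" "p = z \<odot>\<^bsub>M\<^esub> w \<oplus>\<^bsub>M\<^esub> y" for p z y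
    using that X_facts by (simp add: F)
  show ?thesis
  proof (cases "\<exists>e\<in>orth v. f e \<noteq> \<zero>")
    case True
    then obtain e0 where e0: "e0 \<in> orth v" "f e0 \<noteq> \<zero>" by blast
    have slice: "q * card {p \<in> A z. f p = c} \<le> 2 * q ^ (d - 2)" if z: "z \<in> idx B" for z
    proof -
      have zR: "z \<in> carrier R" using z idx by auto
      let ?c = "c \<ominus> z \<otimes> f w"
      have cR: "?c \<in> carrier R" using c zR F(1)[of w] by simp
      have "{p \<in> A z. f p = c} \<subseteq> (\<lambda>y. z \<odot>\<^bsub>M\<^esub> w \<oplus>\<^bsub>M\<^esub> y) ` {y \<in> orth v. Q y = rad B \<and> f y = ?c}"
      proof
        fix p assume p: "p \<in> {p \<in> A z. f p = c}"
        then obtain y where y: "y \<in> X" "p = z \<odot>\<^bsub>M\<^esub> w \<oplus>\<^bsub>M\<^esub> y" by (auto simp: point_block_def)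
        have "z \<otimes> f w \<in> carrier R" "f y \<in> carrier R" using zR F(1) y X_facts by auto
        then have "z \<otimes> f w \<oplus> f y \<ominus> z \<otimes> f w = f y" by algebra
        then have "f y = ?c" using p Aeq[OF zR y] by simp
        then show "p \<in> (\<lambda>y. z \<odot>\<^bsub>M\<^esub> w \<oplus>\<^bsub>M\<^esub> y) ` {y \<in> orth v. Q y = rad B \<and> f y = ?c}"
          using y by (auto simp: base_section_def)
      qed
      then have "card {p \<in> A z. f p = c} \<le> card {y \<in> orth v. Q y = rad B \<and> f y = ?c}"
        by (intro surj_card_le) (auto simp: finite_orth)
      then have "q * card {p \<in> A z. f p = c} \<le> q * card {y \<in> orth v. Q y = rad B \<and> f y = ?c}"
        by simp
      also have "\<dots> \<le> 2 * q ^ (d - 2)"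
        by (rule card_slice_le[OF d _ _ f(1) e0 _ cR]) auto
      finally show ?thesis .
    qed
    have "q * card {p \<in> P. f p = c} \<le> q * (\<Sum>z\<in>idx B. card {p \<in> A z. f p = c})"
      unfolding eq using finite_idx by (intro mult_left_mono card_UN_le) auto
    also have "\<dots> \<le> (\<Sum>z\<in>idx B. 2 * q ^ (d - 2))"
      unfolding sum_distrib_left by (intro sum_mono slice)
    \<comment> \<open>By \<open>wide\<close>, \<open>2 q^(d-2)\<close> is at most
      \<open>4 card X\<close>; this produces the 4 in \<open>4 / q\<close>.\<close>
    also have "\<dots> \<le> card (idx B) * (4 * card X)"
      using wide by simp
    also have "\<dots> = 4 * card P" by (simp add: card_points)
    finally have "real q * real (card {p \<in> P. f p = c}) \<le> 4 * real (card P)"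
      by (metis (mono_tags, lifting) of_nat_le_iff of_nat_mult of_nat_numeral)
    then have "real (card {p \<in> P. f p = c}) \<le> 4 / real q * real (card P)"
      using q_pos by (simp add: field_simps)
    also have "\<dots> \<le> (4 / real q + 1 / real (card (idx B))) * real (card P)"
      by (intro mult_right_mono) auto
    finally show ?thesis .
  next
    case False
    then have f0: "f e = \<zero>" if "e \<in> orth v" for e using that by blast
    \<comment> \<open>Every vector is a multiple of \<open>w\<close> plus an element of
      \<open>orth v\<close>, so a nonzero functional that kills \<open>orth v\<close> cannot kill
      \<open>w\<close>.\<close>
    have "f w \<noteq> \<zero>"
    proof
      assume fw: "f w = \<zero>"
      obtain x where x: "x \<in> carrier M" "f x \<noteq> \<zero>" using f(2) by blast
      have "x \<ominus>\<^bsub>M\<^esub> ip x v \<odot>\<^bsub>M\<^esub> w \<in> orth v"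
        using x by (auto simp: perp_def ip_minus_left ip_smult_left)
      then have "f (x \<ominus>\<^bsub>M\<^esub> ip x v \<odot>\<^bsub>M\<^esub> w) = \<zero>" by (rule f0)
      then show False using x fw F(1)[of x] by (simp add: F(3,4))
    qed
    then have fw: "f w \<noteq> \<zero>" "f w \<in> carrier R" using F(1) by auto
    \<comment> \<open>In this case \<open>f\<close> is a nonzero multiple of pairing with
      \<open>v\<close>, so its value determines the block.\<close>
    have fz: "f p = z \<otimes> f w" if z: "z \<in> idx B" and p: "p \<in> A z" for z p
    proof -
      have zR: "z \<in> carrier R" using z idx by auto
      obtain y where y: "y \<in> X" "p = z \<odot>\<^bsub>M\<^esub> w \<oplus>\<^bsub>M\<^esub> y" using p by (auto simp: point_block_def)
      have "f y = \<zero>" using f0 y by (auto simp: base_section_def)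
      then show ?thesis using Aeq[OF zR y] zR fw by simp
    qed
    have "card {p \<in> P. f p = c} \<le> card X"
    proof (cases "\<exists>z\<in>idx B. z \<otimes> f w = c")
      case True
      then obtain z where z: "z \<in> idx B" "z \<otimes> f w = c" by blast
      have "{p \<in> P. f p = c} \<subseteq> A z"
      proof
        fix p assume "p \<in> {p \<in> P. f p = c}"
        then obtain z' where z': "z' \<in> idx B" "p \<in> A z'" "f p = c" by (auto simp: block_points_def)
        then have "z' \<otimes> f w = z \<otimes> f w" using fz z by simp
        moreover have "z' \<in> carrier R" "z \<in> carrier R" using z z' idx by auto
        ultimately have "z' = z" using fw by (simp add: m_rcancel)
        then show "p \<in> A z" using z' by simp
      qed
      then have "card {p \<in> P. f p = c} \<le> card (A z)" by (intro card_mono finite_point_block)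
      then show ?thesis using card_point_block[of z] z idx by auto
    next
      case False
      then have "{p \<in> P. f p = c} = {}" using fz by (auto simp: block_points_def)
      then show ?thesis by (metis card.empty le0)
    qed
    then have "real (card {p \<in> P. f p = c}) \<le> real (card X)" by simp
    also have "\<dots> = 1 / real (card (idx B)) * real (card P)"
      using t by (simp add: card_points)
    also have "\<dots> \<le> (4 / real q + 1 / real (card (idx B))) * real (card P)"
      by (intro mult_right_mono) auto
    finally show ?thesis .
  qed
qed

lemma card_points_flat:
  assumes d: "d \<ge> 4" and wide: "q ^ (d - 2) \<le> 2 * card X"
    and L: "affine_flat R M L" "L \<noteq> carrier M"
  shows "real (card (P \<inter> L)) \<le> (4 / real q + 1 / real (card (idx B))) * real (card P)"
proof -
  obtain f c where f: "linear_functional f" "\<exists>x\<in>carrier M. f x \<noteq> \<zero>" "c \<in> carrier R" "\<And>x. x \<in> L \<Longrightarrow> f x = c"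
    using affine_flat_functional[OF L] by blast
  have "finite P"
    using finite_idx finite_point_block by (auto simp: block_points_def)
  then have "card (P \<inter> L) \<le> card {p \<in> P. f p = c}"
    using f(4) by (intro card_mono) auto
  then show ?thesis
    using card_points_slice[OF d wide f(1-3)] by linarith
qed

end

section \<open>Coordinate spaces\<close>

lemma finite_quadratic_space_coord_space:
  assumes "(R, Q) \<in> nondeg_spaces d"
  shows "finite_quadratic_space R (coord_space R d) Q d"
proof -
  have R: "field R" "finite (carrier R)" "odd (order R)"
    "quadratic_form R (coord_space R d) Q" "nondegenerate R (coord_space R d) Q"
    using assms by (auto simp: nondeg_spaces_def)
  interpret field R by fact
  interpret Module.module R "coord_space R d"
    by (rule module_coord_space[OF is_cring])
  show ?thesis
  proof
    show "card (carrier (coord_space R d)) = order R ^ d"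
      by (simp add: coord_space_def card_PiE order_def)
  qed (use R in auto)
qed

text \<open>It serves twice: with a fixed first argument it gives the equations of hyperplanes, and
  on the diagonal it is a nondegenerate form over every finite field of odd order.\<close>

definition dot :: "('a, 'm) ring_scheme \<Rightarrow> nat \<Rightarrow> (nat \<Rightarrow> 'a) \<Rightarrow> (nat \<Rightarrow> 'a) \<Rightarrow> 'a" where
  "dot R d x y = (\<Oplus>\<^bsub>R\<^esub>i\<in>{..<d}. x i \<otimes>\<^bsub>R\<^esub> y i)"

context field
begin

lemma coord_closed: "x \<in> carrier (coord_space R d) \<Longrightarrow> i < d \<Longrightarrow> x i \<in> carrier R"
  by (auto simp: coord_space_def)

lemma dot_closed [simp]:
  "x \<in> carrier (coord_space R d) \<Longrightarrow> y \<in> carrier (coord_space R d) \<Longrightarrow> dot R d x y \<in> carrier R"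
  by (auto simp: dot_def coord_closed intro!: finsum_closed)

lemma dot_commute:
  "x \<in> carrier (coord_space R d) \<Longrightarrow> y \<in> carrier (coord_space R d) \<Longrightarrow> dot R d x y = dot R d y x"
  unfolding dot_def by (intro finsum_cong') (auto simp: m_comm coord_closed)

lemma dot_add_right:
  assumes "a \<in> carrier (coord_space R d)" "x \<in> carrier (coord_space R d)" "y \<in> carrier (coord_space R d)"
  shows "dot R d a (x \<oplus>\<^bsub>coord_space R d\<^esub> y) = dot R d a x \<oplus> dot R d a y"
proof -
  have "dot R d a (x \<oplus>\<^bsub>coord_space R d\<^esub> y) = (\<Oplus>i\<in>{..<d}. a i \<otimes> x i \<oplus> a i \<otimes> y i)"
    unfolding dot_def using assms
    by (intro finsum_cong') (auto simp: coord_closed r_distr coord_space_def[of R d, THEN arg_cong[where f = add]])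
  also have "\<dots> = dot R d a x \<oplus> dot R d a y"
    unfolding dot_def using assms by (intro finsum_addf) (auto simp: coord_closed)
  finally show ?thesis .
qed

lemma dot_smult_right:
  assumes "a \<in> carrier (coord_space R d)" "c \<in> carrier R" "x \<in> carrier (coord_space R d)"
  shows "dot R d a (c \<odot>\<^bsub>coord_space R d\<^esub> x) = c \<otimes> dot R d a x"
proof -
  have "dot R d a (c \<odot>\<^bsub>coord_space R d\<^esub> x) = (\<Oplus>i\<in>{..<d}. c \<otimes> (a i \<otimes> x i))"
    unfolding dot_def using assms
    by (intro finsum_cong') (auto simp: coord_closed m_lcomm coord_space_def[of R d, THEN arg_cong[where f = smult]])
  also have "\<dots> = c \<otimes> dot R d a x"
    unfolding dot_def using assms by (intro finsum_rdistr[symmetric]) (auto simp: coord_closed)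
  finally show ?thesis .
qed

lemma dot_unit:
  assumes "a \<in> carrier (coord_space R d)" "i < d"
  shows "(\<lambda>j\<in>{..<d}. if j = i then \<one> else \<zero>) \<in> carrier (coord_space R d)"
    and "dot R d a (\<lambda>j\<in>{..<d}. if j = i then \<one> else \<zero>) = a i"
proof -
  show "(\<lambda>j\<in>{..<d}. if j = i then \<one> else \<zero>) \<in> carrier (coord_space R d)"
    by (auto simp: coord_space_def)
  have "dot R d a (\<lambda>j\<in>{..<d}. if j = i then \<one> else \<zero>) = (\<Oplus>j\<in>{..<d}. if i = j then a j else \<zero>)"
    unfolding dot_def using assms by (intro finsum_cong') (auto simp: coord_closed)
  also have "\<dots> = a i"
    using assms by (intro finsum_singleton) (auto simp: coord_closed)
  finally show "dot R d a (\<lambda>j\<in>{..<d}. if j = i then \<one> else \<zero>) = a i" .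
qed

lemma coord_nonzero:
  assumes "a \<in> carrier (coord_space R d)" "a \<noteq> \<zero>\<^bsub>coord_space R d\<^esub>"
  obtains i where "i < d" "a i \<noteq> \<zero>"
proof (rule ccontr)
  assume "\<not> thesis"
  then have "a i = \<zero>" if "i < d" for i using that \<open>\<And>i. \<lbrakk>i < d; a i \<noteq> \<zero>\<rbrakk> \<Longrightarrow> thesis\<close> by blast
  then have "a = \<zero>\<^bsub>coord_space R d\<^esub>"
    using assms(1) by (auto simp: coord_space_def PiE_iff extensional_def fun_eq_iff)
  with assms(2) show False ..
qed

lemma
  assumes two: "\<one> \<oplus> \<one> \<noteq> \<zero>"
  shows quadratic_form_dot: "quadratic_form R (coord_space R d) (\<lambda>x. dot R d x x)"
    and nondegenerate_dot: "nondegenerate R (coord_space R d) (\<lambda>x. dot R d x x)"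
proof -
  interpret M: Module.module R "coord_space R d"
    by (rule module_coord_space[OF is_cring])
  let ?M = "coord_space R d"
  have h: "inv (\<one> \<oplus> \<one>) \<in> carrier R" "(\<one> \<oplus> \<one>) \<otimes> inv (\<one> \<oplus> \<one>) = \<one>"
    using two by (auto simp: field_Units)
  have dot_add_left: "dot R d (x \<oplus>\<^bsub>?M\<^esub> y) z = dot R d x z \<oplus> dot R d y z"
    if "x \<in> carrier ?M" "y \<in> carrier ?M" "z \<in> carrier ?M" for x y z
    using that by (simp add: dot_commute[of _ _ z] dot_add_right)
  have dot_smult_left: "dot R d (c \<odot>\<^bsub>?M\<^esub> x) y = c \<otimes> dot R d x y"
    if "c \<in> carrier R" "x \<in> carrier ?M" "y \<in> carrier ?M" for x y c
    using that by (simp add: dot_commute[of _ _ y] dot_smult_right)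
  have q: "qinner R ?M (\<lambda>x. dot R d x x) x y = dot R d x y"
    if xy: "x \<in> carrier ?M" "y \<in> carrier ?M" for x y
  proof -
    have alg: "a \<oplus> c \<oplus> (c \<oplus> b) \<ominus> a \<ominus> b = (\<one> \<oplus> \<one>) \<otimes> c"
      if "a \<in> carrier R" "b \<in> carrier R" "c \<in> carrier R" for a b c
      using that by algebra
    have "dot R d (x \<oplus>\<^bsub>?M\<^esub> y) (x \<oplus>\<^bsub>?M\<^esub> y) = dot R d x x \<oplus> dot R d x y \<oplus> (dot R d x y \<oplus> dot R d y y)"
      using xy dot_commute[OF xy] by (simp add: dot_add_left dot_add_right)
    then have "qinner R ?M (\<lambda>x. dot R d x x) x y = (\<one> \<oplus> \<one>) \<otimes> dot R d x y \<otimes> inv (\<one> \<oplus> \<one>)"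
      unfolding qinner_def using xy by (simp add: alg)
    also have "\<dots> = dot R d x y \<otimes> ((\<one> \<oplus> \<one>) \<otimes> inv (\<one> \<oplus> \<one>))"
      using xy h by (simp add: m_ac)
    finally show ?thesis using h xy by simp
  qed
  show "quadratic_form R ?M (\<lambda>x. dot R d x x)"
    unfolding quadratic_form_def
    by (auto simp: q dot_add_left dot_smult_left dot_smult_right m_assoc)
  show "nondegenerate R ?M (\<lambda>x. dot R d x x)"
    unfolding nondegenerate_def
  proof (intro ballI impI, rule ccontr)
    fix x assume x: "x \<in> carrier ?M" and all: "\<forall>y\<in>carrier ?M. qinner R ?M (\<lambda>x. dot R d x x) x y = \<zero>"
      and "x \<noteq> \<zero>\<^bsub>?M\<^esub>"
    then obtain i where i: "i < d" "x i \<noteq> \<zero>" using coord_nonzero by blast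
    note u = dot_unit[OF x i(1)]
    have "x i = \<zero>" using bspec[OF all u(1)] q[OF x u(1)] u(2) by simp
    with i show False by simp
  qed
qed

end

text \<open>The residues modulo a large prime are transported into \<open>'a\<close> along an
  injection of the natural numbers, which exists because \<open>'a\<close> is infinite.\<close>

lemma exists_finite_field:
  obtains R :: "('a::infinite) ring" where "field R" "finite (carrier R)" "odd (order R)" "n \<le> order R"
proof -
  obtain p :: nat where p: "prime p" "p > max n 2" using bigger_prime by blast
  interpret p: residues_prime p "residue_ring (int p)"
    by unfold_locales (simp_all add: p)
  obtain g :: "nat \<Rightarrow> 'a" where g: "inj g"
    using infinite_countable_subset[OF infinite_UNIV] by blast
  let ?f = "\<lambda>x::int. g (nat x)"
  have inj: "inj_on ?f (carrier (residue_ring (int p)))"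
    by (intro inj_onI) (use g in \<open>auto simp: p.res_carrier_eq dest: injD\<close>)
  let ?R = "image_ring ?f (residue_ring (int p))"
  have card: "order ?R = p"
    unfolding order_def image_ring_carrier card_image[OF inj] by (simp add: p.res_carrier_eq)
  show thesis
  proof (rule that)
    show "field ?R" using p.inj_imp_image_ring_is_field[OF inj] .
    show "finite (carrier ?R)" by (simp add: image_ring_carrier)
    show "odd (order ?R)" "n \<le> order ?R"
      unfolding card using p prime_odd_nat by auto
  qed
qed

text \<open>Along a trivial filter every property would hold eventually, and the negated claim about
  hyperplanes would fail. The standard form over large prime fields excludes this.\<close>

lemma large_spaces_nontrivial: "(large_spaces d :: ('a::infinite) qspace filter) \<noteq> bot"
proof
  assume "(large_spaces d :: 'a qspace filter) = bot"
  then have "eventually (\<lambda>_. False) (large_spaces d :: 'a qspace filter)" by simp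
  then obtain n where n: "\<And>R Q. (R :: 'a ring, Q) \<in> nondeg_spaces d \<Longrightarrow> \<not> n \<le> order R"
    unfolding eventually_large_spaces by blast
  obtain R :: "'a ring" where R: "field R" "finite (carrier R)" "odd (order R)" "n \<le> order R"
    by (rule exists_finite_field)
  note two = field.two_nonzero_of_odd_order[OF R(1,3)]
  have "(R, \<lambda>x. dot R d x x) \<in> nondeg_spaces d"
    using R field.quadratic_form_dot[OF R(1) two] field.nondegenerate_dot[OF R(1) two]
    by (auto simp: nondeg_spaces_def)
  then show False using n R(4) by blast
qed

context finite_block_system
begin

lemma subset_carriers: "P \<subseteq> carrier M" "T \<subseteq> carrier M \<times> {rad B}"
  using idx X_facts(1)
  by (auto simp: block_points_def point_block_def block_spheres_def sphere_block_def)

lemma card_points_pos: "card P > 0"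
  using card_X_pos idx finite_idx by (simp add: card_points card_gt_0_iff)

end

section \<open>The surplus constant\<close>

lemma surplus_constant_block:
  fixes R :: "'a ring"
  assumes "finite_block_system R (coord_space R d) Q d B"
  defines "M \<equiv> coord_space R d"
  shows "surplus_constant R d Q (block_points R M Q B) (block_spheres R M B) =
    sqrt (real (card (base_section R M Q B))) * (real (order R) - 1) / real (order R) powr (real d / 2)"
proof -
  interpret finite_block_system R "coord_space R d" Q d B by fact
  have t: "card (idx B) > 0" using idx finite_idx by (simp add: card_gt_0_iff)
  let ?q = "real q" and ?t = "real (card (idx B))" and ?N = "real (card X)"
  have e1: "sqrt ((?t * ?N) * (?t * ?q)) = ?t * (sqrt ?N * sqrt ?q)"
    by (simp add: real_sqrt_mult)
  have "?q powr ((real d - 1) / 2) * sqrt ?q = ?q powr (real d / 2)"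
  proof -
    have "?q powr ((real d - 1) / 2) * sqrt ?q = ?q powr ((real d - 1) / 2 + 1 / 2)"
      using q_pos by (simp add: powr_add powr_half_sqrt)
    also have "(real d - 1) / 2 + 1 / 2 = real d / 2" by (simp add: field_simps)
    finally show ?thesis .
  qed
  then have e2: "?q powr ((real d - 1) / 2) * (?t * (sqrt ?N * sqrt ?q)) = (?t * sqrt ?N) * ?q powr (real d / 2)"
    by (simp add: mult.left_commute)
  have "?N = sqrt ?N * sqrt ?N" by simp
  then have e3: "?t * ?N * (?q - 1) = (?t * sqrt ?N) * (sqrt ?N * (?q - 1))"
    by (metis mult.assoc)
  have ne: "?t * sqrt ?N \<noteq> 0" using t card_X_pos by simp
  have "surplus_constant R d Q P T =
      ?t * ?N * (?q - 1) / (?q powr ((real d - 1) / 2) * sqrt ((?t * ?N) * (?t * ?q)))"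
    by (simp add: surplus_constant_def discrepancy_total card_points card_spheres)
  also have "\<dots> = (?t * sqrt ?N) * (sqrt ?N * (?q - 1)) / ((?t * sqrt ?N) * ?q powr (real d / 2))"
    by (simp only: e1 e2 e3)
  also have "\<dots> = sqrt ?N * (?q - 1) / ?q powr (real d / 2)"
    by (rule mult_divide_mult_cancel_left[OF ne])
  finally show ?thesis unfolding M_def .
qed

text \<open>The square of \<open>K\<close> is the product of \<open>N / m\<close>, between
  \<open>1/2\<close> and \<open>2\<close>, and the square of \<open>(q - 1) / q\<close>, which is at
  least \<open>4/9\<close> and at most one. So \<open>K^2\<close> lies between \<open>2/9\<close>
  and \<open>2\<close>; the bounds \<open>1/4\<close> and \<open>2\<close> for \<open>K\<close> are
  rounded outwards.\<close>

lemma surplus_constant_bounds: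
  fixes q N m K :: real
  assumes q: "q \<ge> 3" and m: "m > 0" "m \<le> 2 * N" "N \<le> 2 * m"
    and K: "K \<ge> 0" "K\<^sup>2 = N * (q - 1)\<^sup>2 / (q\<^sup>2 * m)"
  shows "1 / 4 \<le> K" "K \<le> 2"
proof -
  define \<rho> where "\<rho> = N / m"
  define \<theta> where "\<theta> = (q - 1) / q"
  have K2: "K\<^sup>2 = \<rho> * \<theta>\<^sup>2"
    unfolding K(2) \<rho>_def \<theta>_def using m q by (simp add: field_simps)
  have \<rho>: "1 / 2 \<le> \<rho>" "\<rho> \<le> 2"
    using m by (simp_all add: \<rho>_def field_simps)
  have "2 / 3 \<le> \<theta>" "\<theta> \<le> 1"
    using q by (simp_all add: \<theta>_def field_simps)
  then have \<theta>: "(2 / 3)\<^sup>2 \<le> \<theta>\<^sup>2" "\<theta>\<^sup>2 \<le> 1"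
    by (intro power_mono power_le_one; simp)+
  have "1 / 2 * (2 / 3)\<^sup>2 \<le> \<rho> * \<theta>\<^sup>2"
    using \<rho> \<theta> by (intro mult_mono) auto
  then have "(1 / 4)\<^sup>2 \<le> K\<^sup>2" using K2 by (simp add: power2_eq_square)
  then show "1 / 4 \<le> K" using K(1) by (rule power2_le_imp_le)
  have "\<rho> * \<theta>\<^sup>2 \<le> 2 * 1"
    using \<rho> \<theta> by (intro mult_mono) auto
  then have "K\<^sup>2 \<le> 2\<^sup>2" using K2 by simp
  then show "K \<le> 2" by (rule power2_le_imp_le) simp
qed

text \<open>
  The window requires \<open>t \<le> C1 K q^((d-3)/2)\<close>, which for \<open>d = 4\<close> is of order \<open>sqrt q\<close>; the factor
  \<open>1/4\<close> is the lower bound for \<open>K\<close>.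
\<close>

definition block_number :: "nat \<Rightarrow> nat" where
  "block_number n = nat \<lfloor>sqrt (real n) / 4\<rfloor>"

text \<open>The bound on shares as a function of \<open>q\<close> alone, so that its limit can be
  taken over the natural numbers. For \<open>n < 16\<close> the block number is zero and the second
  summand is zero by the convention for division; only large \<open>n\<close> matter.\<close>

definition share_bound :: "nat \<Rightarrow> real" where
  "share_bound n = 4 / real n + 1 / real (block_number n)"

lemma filterlim_block_number: "filterlim block_number at_top at_top"
  unfolding filterlim_at_top
proof
  fix k :: nat
  have "k \<le> block_number n" if "(4 * k)\<^sup>2 \<le> n" for n
  proof -
    have "(4 * real k)\<^sup>2 \<le> real n"
      using that by (metis of_nat_le_iff of_nat_mult of_nat_numeral of_nat_power)
    then have "4 * real k \<le> sqrt (real n)"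
      by (rule real_le_rsqrt)
    then have "real k \<le> sqrt (real n) / 4"
      by simp
    then show ?thesis unfolding block_number_def by (rule le_nat_floor)
  qed
  then show "\<forall>\<^sub>F n in at_top. k \<le> block_number n"
    unfolding eventually_at_top_linorder by blast
qed

lemma share_bound_tendsto_0: "(share_bound \<longlongrightarrow> 0) at_top"
proof -
  have "((\<lambda>n. 4 / real n) \<longlongrightarrow> 0) at_top"
    by (rule lim_const_over_n)
  moreover have "((\<lambda>n. 1 / real (block_number n)) \<longlongrightarrow> 0) at_top"
    by (rule filterlim_compose[OF lim_1_over_n filterlim_block_number])
  ultimately have "((\<lambda>n. 4 / real n + 1 / real (block_number n)) \<longlongrightarrow> 0 + 0) at_top"
    by (rule tendsto_add)
  then show ?thesis by (simp add: share_bound_def[abs_def])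
qed

lemma block_number_le: "4 * real (block_number n) \<le> sqrt (real n)"
proof -
  have "real (block_number n) \<le> sqrt (real n) / 4"
    unfolding block_number_def by (rule of_nat_floor) simp
  then show ?thesis by simp
qed

lemma block_number_le_self:
  assumes "n > 0" shows "block_number n \<le> n"
proof -
  have "sqrt (real n) \<le> real n" using assms by (intro real_le_lsqrt) (auto simp: self_le_power)
  then show ?thesis using block_number_le[of n] by linarith
qed

section \<open>Limits along growing fields, and hyperplanes in coordinates\<close>

lemma filterlim_order_large_spaces:
  "filterlim (\<lambda>(R, Q). order R) at_top (large_spaces d)"
  unfolding large_spaces_def
  by (rule filterlim_mono[OF filterlim_filtercomap order_refl inf_le1])

lemma eventually_order_large_spaces:
  assumes "eventually p at_top"
  shows "\<forall>\<^sub>F (R, Q) in large_spaces d. p (order R)"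
  using filterlim_order_large_spaces[of d] assms unfolding filterlim_iff by (auto simp: case_prod_unfold)

lemma eventually_nondeg_spaces: "\<forall>\<^sub>F (R, Q) in large_spaces d. (R, Q) \<in> nondeg_spaces d"
  unfolding eventually_large_spaces by auto

lemma hyperplane_functional:
  assumes "(R, Q) \<in> nondeg_spaces d" "H \<in> hyperplanes R d"
  obtains f c where "finite_quadratic_space.linear_functional R (coord_space R d) f"
    "\<exists>x\<in>carrier (coord_space R d). f x \<noteq> \<zero>\<^bsub>R\<^esub>" "c \<in> carrier R"
    "H = {x \<in> carrier (coord_space R d). f x = c}"
proof -
  interpret finite_quadratic_space R "coord_space R d" Q d
    by (rule finite_quadratic_space_coord_space[OF assms(1)])
  obtain a b where ab: "a \<in> carrier (coord_space R d)" "a \<noteq> \<zero>\<^bsub>coord_space R d\<^esub>" "b \<in> carrier R"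
    "H = {x \<in> carrier (coord_space R d). dot R d a x = b}"
    using assms(2) by (auto simp: hyperplanes_def dot_def)
  show thesis
  proof (rule that)
    show "linear_functional (dot R d a)"
      using ab(1) by (auto simp: linear_functional_def dot_add_right dot_smult_right)
    obtain i where "i < d" "a i \<noteq> \<zero>\<^bsub>R\<^esub>" using coord_nonzero ab(1,2) by blast
    then show "\<exists>x\<in>carrier (coord_space R d). dot R d a x \<noteq> \<zero>\<^bsub>R\<^esub>"
      using dot_unit[OF ab(1), of i] by (intro bexI[where x = "\<lambda>j\<in>{..<d}. if j = i then \<one>\<^bsub>R\<^esub> else \<zero>\<^bsub>R\<^esub>"]) simp_all
  qed (use ab in auto)
qed

text \<open>\<open>MAX\<close> over the hyperplanes is meaningful only for a finite nonempty family;
  the first coordinate functional provides a member.\<close>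

lemma hyperplanes_finite_nonempty:
  assumes "(R, Q) \<in> nondeg_spaces d" "d > 0"
  shows "finite (hyperplanes R d)" "hyperplanes R d \<noteq> {}"
proof -
  interpret finite_quadratic_space R "coord_space R d" Q d
    by (rule finite_quadratic_space_coord_space[OF assms(1)])
  have "hyperplanes R d \<subseteq> Pow (carrier (coord_space R d))"
    by (auto simp: hyperplanes_def)
  then show "finite (hyperplanes R d)"
    using finite_vectors by (simp add: finite_subset)
  let ?e = "\<lambda>j\<in>{..<d}. if j = 0 then \<one>\<^bsub>R\<^esub> else \<zero>\<^bsub>R\<^esub>"
  have e: "?e \<in> carrier (coord_space R d)"
    by (auto simp: coord_space_def)
  have "?e 0 \<noteq> \<zero>\<^bsub>coord_space R d\<^esub> 0"
    using assms(2) by (simp add: coord_space_def)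
  then have "?e \<noteq> \<zero>\<^bsub>coord_space R d\<^esub>" by metis
  then have "{x \<in> carrier (coord_space R d). (\<Oplus>\<^bsub>R\<^esub>i\<in>{..<d}. ?e i \<otimes>\<^bsub>R\<^esub> x i) = \<zero>\<^bsub>R\<^esub>} \<in> hyperplanes R d"
    using e unfolding hyperplanes_def by blast
  then show "hyperplanes R d \<noteq> {}" by blast
qed

text \<open>The window is stated with constant one and the shares with a bound depending on
  \<open>q\<close> only. One choice of systems therefore serves all \<open>C1\<close>,
  \<open>c\<close>, \<open>C\<close> and \<open>\<delta>\<close>.\<close>

definition good_system ::
    "nat \<Rightarrow> 'a ring \<Rightarrow> ((nat \<Rightarrow> 'a) \<Rightarrow> 'a) \<Rightarrow> ('a, nat \<Rightarrow> 'a) block_data \<Rightarrow> bool" where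
  "good_system d R Q B \<longleftrightarrow>
    (let M = coord_space R d; P = block_points R M Q B; T = block_spheres R M B;
         K = surplus_constant R d Q P T; q = real (order R)
     in block_system R M Q B \<and> exact_centered_blocks R M Q B \<and>
        card (idx B) = block_number (order R) \<and> 1 / 4 \<le> K \<and> K \<le> 2 \<and>
        4 * q / K\<^sup>2 \<le> real (card T) \<and> real (card T) \<le> K * q powr ((real d - 1) / 2) \<and>
        fixed_scale_surplus R d Q K P T \<and> 4 * real (card P) / (K\<^sup>2 * q ^ (d - 1)) \<le> real (card T) \<and>
        0 < card P \<and> P \<subseteq> carrier M \<and> T \<subseteq> carrier M \<times> {rad B} \<and>
        (\<forall>H\<in>hyperplanes R d. real (card (P \<inter> H)) \<le> share_bound (order R) * real (card P)) \<and>
        (\<forall>L. affine_flat R M L \<and> L \<noteq> carrier M \<longrightarrow>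
          real (card (P \<inter> L)) \<le> share_bound (order R) * real (card P)) \<and>
        (\<forall>L. totally_singular_flat R M Q L \<longrightarrow>
          real (card (P \<inter> L)) \<le> share_bound (order R) * real (card P)))"

lemma exists_good_system:
  fixes R :: "'a ring"
  assumes RQ: "(R, Q) \<in> nondeg_spaces d" and d: "d \<ge> 4" and large: "64 \<le> block_number (order R)"
  shows "\<exists>B. good_system d R Q B"
proof -
  define M where "M = coord_space R d"
  interpret finite_quadratic_space R M Q d
    unfolding M_def by (rule finite_quadratic_space_coord_space[OF RQ])
  define t where "t = block_number q"
  have t: "0 < t" "t \<le> q" and t64: "64 \<le> t"
    using large block_number_le_self[OF q_pos] by (auto simp: t_def)
  obtain B where B: "block_system R M Q B" "card (idx B) = t"
    "q ^ (d - 2) \<le> 2 * card (base_section R M Q B)"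
    "card (base_section R M Q B) \<le> 2 * q ^ (d - 2)"
    using exists_wide_block_system[of t] t d by auto
  interpret finite_block_system R M Q d B
    by unfold_locales (rule B(1))
  define K where "K = surplus_constant R d Q P T"
  have Keq: "K = sqrt (real (card X)) * (real q - 1) / real q powr (real d / 2)"
    unfolding K_def M_def using finite_block_system_axioms
    by (intro surplus_constant_block) (simp add: M_def)
  have q3: "real q \<ge> 3" using q_ge_3 by simp
  define m where "m = real q ^ (d - 2)"
  have m: "m > 0" "m \<le> 2 * real (card X)" "real (card X) \<le> 2 * m"
    using q_pos B(3,4) by (simp_all add: m_def) (metis of_nat_le_iff of_nat_mult of_nat_numeral of_nat_power)+
  have qd: "(real q powr (real d / 2))\<^sup>2 = (real q)\<^sup>2 * m"
  proof -
    have "(real q powr (real d / 2))\<^sup>2 = real q powr (real d)"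
      using q_pos by (simp add: powr_power)
    also have "\<dots> = real q ^ d"
      using q_pos by (simp add: powr_realpow)
    also have "\<dots> = real q ^ (2 + (d - 2))"
      using d by (intro arg_cong[where f = "power (real q)"]) simp
    finally show ?thesis unfolding power_add m_def .
  qed
  have K2: "K\<^sup>2 = real (card X) * (real q - 1)\<^sup>2 / ((real q)\<^sup>2 * m)"
    unfolding Keq power_divide power_mult_distrib qd by simp
  have "K \<ge> 0" unfolding Keq using q3 by simp
  note K = surplus_constant_bounds[OF q3 m this K2]
  have K16: "1 / 16 \<le> K\<^sup>2"
    using power_mono[OF K(1), of 2] by (simp add: power2_eq_square)
  have cT: "real (card T) = real t * real q" by (simp add: card_spheres B(2))
  have cP: "real (card P) = real t * real (card X)" by (simp add: card_points B(2))
  \<comment> \<open>The threshold 64 is four divided by \<open>1/16\<close>, the lower bound for the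
    square of \<open>K\<close>.\<close>
  have "4 * real q / K\<^sup>2 \<le> 4 * real q / (1 / 16)"
    using K16 q3 by (intro divide_left_mono) auto
  also have "\<dots> = 64 * real q" by simp
  also have "\<dots> \<le> real t * real q"
    using t64 by (intro mult_right_mono) auto
  finally have low: "4 * real q / K\<^sup>2 \<le> real (card T)" using cT by simp
  \<comment> \<open>The factor \<open>1/4\<close> in the block number is absorbed by
    \<open>K \<ge> 1/4\<close>, and the exponent \<open>3/2\<close> is at most
    \<open>(d - 1) / 2\<close> because \<open>d \<ge> 4\<close>.\<close>
  have "real t * real q \<le> (1 / 4 * sqrt (real q)) * real q"
    using block_number_le[of q] by (intro mult_right_mono) (auto simp: t_def)
  also have "\<dots> = 1 / 4 * real q powr (1 / 2 + 1)"
    unfolding powr_add using q3 by (simp add: powr_half_sqrt)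
  also have "\<dots> \<le> K * real q powr ((real d - 1) / 2)"
    using K(1) d q3 by (intro mult_mono powr_mono) auto
  finally have high: "real (card T) \<le> K * real q powr ((real d - 1) / 2)" using cT by simp
  have qd1: "real q ^ (d - 1) = real q * m"
    using d unfolding m_def by (simp flip: power_Suc add: Suc_diff_Suc numeral_2_eq_2)
  \<comment> \<open>\<open>card X \<le> 2 m\<close> and \<open>K^2 \<ge> 1/16\<close> leave
    \<open>128 t / q\<close>. This is at most \<open>t q\<close>, as \<open>t \<ge> 64\<close>
    already forces \<open>q \<ge> 64\<close>.\<close>
  have "4 * real (card P) / (K\<^sup>2 * (real q * m)) \<le> 4 * (real t * (2 * m)) / (1 / 16 * (real q * m))"
    unfolding cP using K16 q3 m(3) m(1) by (intro frac_le mult_mono mult_nonneg_nonneg mult_pos_pos) auto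
  also have "4 * (real t * (2 * m)) / (1 / 16 * (real q * m)) = real t * (128 / real q)"
    using m(1) q3 by (simp add: field_simps)
  also have "\<dots> \<le> real t * real q"
  proof (intro mult_left_mono)
    have "real q \<ge> 64" using t t64 by simp
    then have "64 * 64 \<le> real q * real q" by (intro mult_mono) auto
    then show "128 / real q \<le> real q" using q3 by (simp add: field_simps)
  qed simp
  finally have window: "4 * real (card P) / (K\<^sup>2 * real q ^ (d - 1)) \<le> real (card T)" unfolding cT qd1 .
  \<comment> \<open>\<open>K\<close> is a quotient by this quantity; once it is nonzero, the surplus
    inequality holds with equality.\<close>
  have D: "real q powr ((real d - 1) / 2) * sqrt (real (card P) * real (card T)) \<noteq> 0"
    using card_points_pos q_pos t by (simp add: card_spheres B(2))
  have surplus: "fixed_scale_surplus R d Q K P T"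
    unfolding fixed_scale_surplus_def K_def surplus_constant_def M_def[symmetric]
    using D by simp
  have share: "share_bound q = 4 / real q + 1 / real (card (idx B))"
    by (simp add: share_bound_def B(2) t_def)
  have flats: "real (card (P \<inter> L)) \<le> share_bound q * real (card P)"
    if "affine_flat R M L" "L \<noteq> carrier M" for L
    unfolding share by (rule card_points_flat[OF d B(3) that])
  have hyper: "real (card (P \<inter> H)) \<le> share_bound q * real (card P)" if H: "H \<in> hyperplanes R d" for H
  proof -
    obtain f c where f: "linear_functional f" "\<exists>x\<in>carrier M. f x \<noteq> \<zero>\<^bsub>R\<^esub>" "c \<in> carrier R"
      "H = {x \<in> carrier M. f x = c}"
      using hyperplane_functional[OF RQ H] unfolding M_def by blast
    have "P \<inter> H = {p \<in> P. f p = c}" using subset_carriers(1) f(4) by auto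
    then show ?thesis unfolding share using card_points_slice[OF d B(3) f(1-3)] by simp
  qed
  have sing: "real (card (P \<inter> L)) \<le> share_bound q * real (card P)"
    if "totally_singular_flat R M Q L" for L
    using flats singular_flat[OF that] d by simp
  have "good_system d R Q B"
    unfolding good_system_def Let_def M_def[symmetric] K_def[symmetric]
    using B(1,2) exact_blocks K low high surplus window card_points_pos subset_carriers hyper flats sing
    by (simp add: t_def)
  then show ?thesis by blast
qed

lemma max_hyperplane_share_bounds:
  assumes RQ: "(R, Q) \<in> nondeg_spaces d" and d: "d > 0" and P: "card P > 0"
    and share: "\<And>H. H \<in> hyperplanes R d \<Longrightarrow> real (card (P \<inter> H)) \<le> \<epsilon> * real (card P)"
  shows "0 \<le> max_hyperplane_share R d P" "max_hyperplane_share R d P \<le> \<epsilon>"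
proof -
  note H = hyperplanes_finite_nonempty[OF RQ d]
  let ?S = "(\<lambda>H. real (card (P \<inter> H)) / real (card P)) ` hyperplanes R d"
  have mem: "max_hyperplane_share R d P \<in> ?S"
    unfolding max_hyperplane_share_def using H by (intro Max_in) auto
  then show "0 \<le> max_hyperplane_share R d P" by auto
  have "x \<le> \<epsilon>" if "x \<in> ?S" for x
    using that share P by (auto simp: field_simps)
  then show "max_hyperplane_share R d P \<le> \<epsilon>" using mem by blast
qed

text \<open>For \<open>C \<ge> 0\<close> the bound rests on \<open>K\<close> being at most 4, for
  negative \<open>C\<close> on \<open>K\<close> being at least \<open>1/4\<close>. It is positive
  and independent of \<open>q\<close>, so shares tending to zero eventually fall below
  \<open>c K^(-C)\<close>.\<close>

lemma powr_lower_bound: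
  fixes K C :: real
  assumes "1 / 4 \<le> K" "K \<le> 2"
  shows "(1 / 4) powr \<bar>C\<bar> \<le> K powr (- C)"
proof (cases "C \<ge> 0")
  case True
  have "(1 / 4) powr C = 4 powr (- C)"
    by (simp add: powr_minus powr_divide field_simps)
  also have "\<dots> \<le> K powr (- C)"
    using True assms by (intro powr_mono2') auto
  finally show ?thesis using True by simp
next
  case False
  then show ?thesis
    using assms powr_mono2[of "- C" "1 / 4" K] by simp
qed

section \<open>Ternary systems, and consequences of good systems\<close>

lemma exists_ternary_system:
  fixes R :: "'a ring"
  assumes RQ: "(R, Q) \<in> nondeg_spaces 3" and t: "0 < t" "t \<le> order R"
  defines "M \<equiv> coord_space R 3"
  obtains B where "block_system R M Q B" "exact_centered_blocks R M Q B" "card (idx B) = t"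
    "card (block_spheres R M B) = t * order R"
    "surplus_constant R 3 Q (block_points R M Q B) (block_spheres R M B) =
      (1 - 1 / real (order R)) * sqrt 2"
    "\<And>z. z \<in> idx B \<Longrightarrow> discrepancy R M Q (point_block R M Q B z) (sphere_block R M B z) =
      discrepancy R M Q (block_points R M Q B) (block_spheres R M B) / real t"
proof -
  interpret finite_quadratic_space R M Q 3
    unfolding M_def by (rule finite_quadratic_space_coord_space[OF RQ])
  obtain B where B: "block_system R M Q B" "card (idx B) = t" "card (base_section R M Q B) = 2 * q"
    using exists_ternary_block_system[OF refl t] by blast
  interpret finite_block_system R M Q 3 B
    by unfold_locales (rule B(1))
  have "surplus_constant R 3 Q P T = sqrt (real (card X)) * (real q - 1) / real q powr (real 3 / 2)"
    unfolding M_def using finite_block_system_axioms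
    by (intro surplus_constant_block) (simp add: M_def)
  also have "real q powr (real 3 / 2) = sqrt (real q) * real q"
  proof -
    have "real q powr (1 / 2 + 1) = sqrt (real q) * real q"
      unfolding powr_add using q_pos by (simp add: powr_half_sqrt)
    then show ?thesis by simp
  qed
  also have "sqrt (real (card X)) * (real q - 1) / (sqrt (real q) * real q) = (1 - 1 / real q) * sqrt 2"
    using q_pos by (simp add: B(3) real_sqrt_mult field_simps)
  finally have K: "surplus_constant R 3 Q P T = (1 - 1 / real q) * sqrt 2" .
  have "discrepancy R M Q (A z) (\<S> z) = discrepancy R M Q P T / real t" if "z \<in> idx B" for z
    using that idx t by (auto simp: discrepancy_blocks discrepancy_total B(2))
  then show thesis
    using that[of B] B exact_blocks K card_spheres by simp
qed

text \<open>The limits concern one function from spaces to systems, so a good system is chosen for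
  each space; the value is arbitrary on the small fields where none is guaranteed.\<close>

lemma eventually_good_system:
  assumes d: "d \<ge> 4"
  obtains sys :: "'a ring \<Rightarrow> ((nat \<Rightarrow> 'a) \<Rightarrow> 'a) \<Rightarrow> ('a, nat \<Rightarrow> 'a) block_data"
  where "\<forall>\<^sub>F (R, Q) in large_spaces d. (R, Q) \<in> nondeg_spaces d \<and> good_system d R Q (sys R Q)"
proof
  let ?sys = "\<lambda>(R :: 'a ring) Q. SOME B. good_system d R Q B"
  have "\<forall>\<^sub>F n in at_top. 64 \<le> block_number n"
    using filterlim_block_number unfolding filterlim_at_top by blast
  then have "\<forall>\<^sub>F (R, Q) in large_spaces d. 64 \<le> block_number (order R)"
    by (rule eventually_order_large_spaces)
  with eventually_nondeg_spaces
  show "\<forall>\<^sub>F (R, Q) in large_spaces d. (R, Q) \<in> nondeg_spaces d \<and> good_system d R Q (?sys R Q)"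
  proof eventually_elim
    case (elim x)
    then show ?case
      using exists_good_system[OF _ d, THEN someI_ex] by (cases x) auto
  qed
qed

lemma good_system_window:
  assumes "good_system d R Q B" and C1: "C1 \<ge> 1"
  defines "P \<equiv> block_points R (coord_space R d) Q B" and "T \<equiv> block_spheres R (coord_space R d) B"
  shows "real (card T) \<le> C1 * surplus_constant R d Q P T * real (order R) powr ((real d - 1) / 2)"
    and "moderate_window R d C1 (surplus_constant R d Q P T) P T"
proof -
  let ?K = "surplus_constant R d Q P T"
  have K: "?K \<ge> 1 / 4" "real (card T) \<le> ?K * real (order R) powr ((real d - 1) / 2)"
    "4 * real (card P) / (?K\<^sup>2 * real (order R) ^ (d - 1)) \<le> real (card T)"
    using assms(1) by (auto simp: good_system_def Let_def P_def T_def)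
  have "1 * (?K * real (order R) powr ((real d - 1) / 2)) \<le> C1 * (?K * real (order R) powr ((real d - 1) / 2))"
    using C1 K(1) by (intro mult_right_mono) auto
  then show *: "real (card T) \<le> C1 * ?K * real (order R) powr ((real d - 1) / 2)"
    using K(2) by (simp add: mult.assoc)
  show "moderate_window R d C1 ?K P T"
    unfolding moderate_window_def using K(3) * by blast
qed

lemma good_system_small_share:
  assumes good: "good_system d R Q B" and c: "c > 0"
    and small: "share_bound (order R) < c * (1 / 4) powr \<bar>C\<bar>" and H: "H \<in> hyperplanes R d"
  defines "P \<equiv> block_points R (coord_space R d) Q B" and "T \<equiv> block_spheres R (coord_space R d) B"
  shows "real (card (P \<inter> H)) < c * surplus_constant R d Q P T powr (- C) * real (card P)"
proof -
  let ?K = "surplus_constant R d Q P T"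
  have K: "1 / 4 \<le> ?K" "?K \<le> 2" "0 < card P" "real (card (P \<inter> H)) \<le> share_bound (order R) * real (card P)"
    using good H by (auto simp: good_system_def Let_def P_def T_def)
  note K(4)
  also have "share_bound (order R) * real (card P) < c * (1 / 4) powr \<bar>C\<bar> * real (card P)"
    using small K(3) by (intro mult_strict_right_mono) auto
  also have "\<dots> \<le> c * ?K powr (- C) * real (card P)"
    using powr_lower_bound[OF K(1,2), of C] c by (intro mult_right_mono mult_left_mono) auto
  finally show ?thesis .
qed

lemma good_system_max_share:
  assumes RQ: "(R, Q) \<in> nondeg_spaces d" and d: "d > 0" and good: "good_system d R Q B"
  defines "P \<equiv> block_points R (coord_space R d) Q B"
  shows "0 \<le> max_hyperplane_share R d P" "max_hyperplane_share R d P \<le> share_bound (order R)"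
proof -
  have P: "card P > 0"
    and share: "\<And>H. H \<in> hyperplanes R d \<Longrightarrow> real (card (P \<inter> H)) \<le> share_bound (order R) * real (card P)"
    using good by (auto simp: good_system_def Let_def P_def)
  show "0 \<le> max_hyperplane_share R d P" "max_hyperplane_share R d P \<le> share_bound (order R)"
    by (rule max_hyperplane_share_bounds[OF RQ d P share]; assumption)+
qed

lemma eventually_share_bound:
  assumes "\<epsilon> > 0"
  shows "\<forall>\<^sub>F (R, Q) in large_spaces d. share_bound (order R) < \<epsilon>"
  using order_tendstoD(2)[OF share_bound_tendsto_0 assms] by (rule eventually_order_large_spaces)

section \<open>Passage to large \<open>q\<close> for systems in dimension at least four and for
  ternary systems\<close>

theorem corollary4p2:
  shows
   "(\<forall>d\<ge>4. \<forall>C1\<ge>1.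
      (\<exists>sys :: ('a::infinite) ring \<Rightarrow> ((nat \<Rightarrow> 'a) \<Rightarrow> 'a) \<Rightarrow> ('a, nat \<Rightarrow> 'a) block_data.
        (\<forall>\<^sub>F (R, Q) in large_spaces d.
          let M = coord_space R d; B = sys R Q;
              P = block_points R M Q B; T = block_spheres R M B;
              K = surplus_constant R d Q P T; q = real (order R)
          in block_system R M Q B \<and> exact_centered_blocks R M Q B \<and>
             4 * q / K\<^sup>2 \<le> real (card T) \<and>
             real (card T) \<le> C1 * K * q powr ((real d - 1) / 2)) \<and>
        ((\<lambda>(R, Q). max_hyperplane_share R d (block_points R (coord_space R d) Q (sys R Q)))
          \<longlongrightarrow> 0) (large_spaces d) \<and>
        filterlim (\<lambda>(R, Q). card (idx (sys R Q))) at_top (large_spaces d) \<and>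
        (\<forall>c>0. \<forall>C. \<forall>\<^sub>F (R, Q) in large_spaces d.
          let M = coord_space R d; B = sys R Q;
              P = block_points R M Q B; T = block_spheres R M B;
              K = surplus_constant R d Q P T
          in K > 0 \<and> fixed_scale_surplus R d Q K P T \<and> moderate_window R d C1 K P T \<and>
             (\<forall>H\<in>hyperplanes R d. real (card (P \<inter> H)) < c * K powr (- C) * real (card P))) \<and>
        (\<forall>\<delta>>0. \<forall>\<^sub>F (R, Q) in large_spaces d.
          let M = coord_space R d; P = block_points R M Q (sys R Q)
          in (\<forall>L. affine_flat R M L \<and> L \<noteq> carrier M \<longrightarrow>
                real (card (P \<inter> L)) \<le> \<delta> * real (card P)) \<and>
             (\<forall>L. totally_singular_flat R M Q L \<longrightarrow>
                real (card (P \<inter> L)) \<le> \<delta> * real (card P)))) \<and>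
      (\<forall>c>0. \<forall>C. \<not> (\<forall>\<^sub>F (R, Q) in (large_spaces d :: 'a qspace filter).
          \<forall>P T r K. P \<subseteq> carrier (coord_space R d) \<and>
            r \<in> carrier R \<and> r \<noteq> \<zero>\<^bsub>R\<^esub> \<and> T \<subseteq> carrier (coord_space R d) \<times> {r} \<and>
            K > 0 \<and> K = surplus_constant R d Q P T \<and>
            fixed_scale_surplus R d Q K P T \<and> moderate_window R d C1 K P T \<longrightarrow>
            (\<exists>H\<in>hyperplanes R d. real (card (P \<inter> H)) \<ge> c * K powr (- C) * real (card P)))))
    \<and>
    (\<forall>t\<ge>3. \<forall>C1 > real t / sqrt 2.
      \<forall>\<^sub>F (R, Q) in (large_spaces 3 :: 'a qspace filter).
        \<exists>B. let M = coord_space R 3;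
                P = block_points R M Q B; T = block_spheres R M B;
                K = surplus_constant R 3 Q P T; q = real (order R)
            in block_system R M Q B \<and> exact_centered_blocks R M Q B \<and> card (idx B) = t \<and>
               4 * q / K\<^sup>2 \<le> real (card T) \<and>
               card T = t * order R \<and>
               real (card T) \<le> C1 * K * q \<and>
               K = (1 - 1 / q) * sqrt 2 \<and>
               (\<forall>z\<in>idx B. discrepancy R M Q (point_block R M Q B z) (sphere_block R M B z) =
                  discrepancy R M Q P T / real t) \<and>
               (\<forall>b\<in>idx B. \<forall>z\<in>idx B. b \<noteq> z \<longrightarrow>
                  discrepancy R M Q (point_block R M Q B b) (sphere_block R M B z) = 0))"
proof (intro conjI allI impI, goal_cases)
  case (1 d C1)
  obtain sys :: "'a ring \<Rightarrow> ((nat \<Rightarrow> 'a) \<Rightarrow> 'a) \<Rightarrow> ('a, nat \<Rightarrow> 'a) block_data"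
    where good: "\<forall>\<^sub>F (R, Q) in large_spaces d. (R, Q) \<in> nondeg_spaces d \<and> good_system d R Q (sys R Q)"
    using eventually_good_system[OF \<open>4 \<le> d\<close>] by blast
  show ?case
  proof (intro exI[of _ sys] conjI allI impI, goal_cases)
    case 1
    show ?case
      using good
    proof eventually_elim
      case (elim x)
      then show ?case
        using good_system_window(1)[OF _ \<open>1 \<le> C1\<close>] by (cases x) (auto simp: good_system_def Let_def)
    qed
  next
    case 2
    show ?case
    proof (rule tendsto_sandwich[OF _ _ tendsto_const])
      show "((\<lambda>(R, Q). share_bound (order R)) \<longlongrightarrow> 0) (large_spaces d :: 'a qspace filter)"
        using filterlim_compose[OF share_bound_tendsto_0 filterlim_order_large_spaces]
        by (simp add: case_prod_unfold)
      show "\<forall>\<^sub>F x in large_spaces d. 0 \<le>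
          (case x of (R, Q) \<Rightarrow> max_hyperplane_share R d (block_points R (coord_space R d) Q (sys R Q)))"
        using good
      proof eventually_elim
        case (elim x)
        obtain R Q where x: "x = (R, Q)" by (cases x)
        show ?case
          using elim \<open>4 \<le> d\<close> good_system_max_share(1)[of R Q d "sys R Q"] by (simp add: x)
      qed
      show "\<forall>\<^sub>F x in large_spaces d.
          (case x of (R, Q) \<Rightarrow> max_hyperplane_share R d (block_points R (coord_space R d) Q (sys R Q)))
          \<le> (case x of (R, Q) \<Rightarrow> share_bound (order R))"
        using good
      proof eventually_elim
        case (elim x)
        obtain R Q where x: "x = (R, Q)" by (cases x)
        show ?case
          using elim \<open>4 \<le> d\<close> good_system_max_share(2)[of R Q d "sys R Q"] by (simp add: x)
      qed
    qed
  next
    case 3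
    have "filterlim (\<lambda>(R, Q). block_number (order R)) at_top (large_spaces d :: 'a qspace filter)"
      using filterlim_compose[OF filterlim_block_number filterlim_order_large_spaces]
      by (simp add: case_prod_unfold)
    moreover have "\<forall>\<^sub>F x in large_spaces d. (case x of (R, Q) \<Rightarrow> block_number (order R)) =
        (case x of (R, Q) \<Rightarrow> card (idx (sys R Q)))"
      using good
    proof eventually_elim
      case (elim x)
      then show ?case by (cases x) (auto simp: good_system_def Let_def)
    qed
    ultimately show ?case
      using filterlim_cong[OF refl refl] by blast
  next
    case (4 c C)
    then have "c * (1 / 4) powr \<bar>C\<bar> > 0" by simp
    from eventually_share_bound[OF this, of d] good show ?case
    proof eventually_elim
      case (elim x)
      obtain R Q where x: "x = (R, Q)" by (cases x)
      have g: "good_system d R Q (sys R Q)" and s: "share_bound (order R) < c * (1 / 4) powr \<bar>C\<bar>"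
        using elim by (auto simp: x)
      show ?case
        using g good_system_window(2)[OF g \<open>1 \<le> C1\<close>] good_system_small_share[OF g \<open>0 < c\<close> s]
        by (auto simp: x good_system_def Let_def)
    qed
  next
    case (5 \<delta>)
    from eventually_share_bound[OF this, of d] good show ?case
    proof eventually_elim
      case (elim x)
      obtain R Q where x: "x = (R, Q)" by (cases x)
      define P where "P = block_points R (coord_space R d) Q (sys R Q)"
      have \<delta>: "share_bound (order R) * real (card P) \<le> \<delta> * real (card P)"
        using elim by (intro mult_right_mono) (auto simp: x)
      have "real (card (P \<inter> L)) \<le> share_bound (order R) * real (card P)"
        if "affine_flat R (coord_space R d) L \<and> L \<noteq> carrier (coord_space R d)" for L
        using elim(2) that by (simp add: x good_system_def Let_def P_def)
      moreover have "real (card (P \<inter> L)) \<le> share_bound (order R) * real (card P)"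
        if "totally_singular_flat R (coord_space R d) Q L" for L
        using elim(2) that by (simp add: x good_system_def Let_def P_def)
      ultimately show ?case
        unfolding x prod.case Let_def P_def[symmetric] using order_trans[OF _ \<delta>] by blast
    qed
  qed
next
  case (2 d C1 c C)
  obtain sys :: "'a ring \<Rightarrow> ((nat \<Rightarrow> 'a) \<Rightarrow> 'a) \<Rightarrow> ('a, nat \<Rightarrow> 'a) block_data"
    where good: "\<forall>\<^sub>F (R, Q) in large_spaces d. (R, Q) \<in> nondeg_spaces d \<and> good_system d R Q (sys R Q)"
    using eventually_good_system[OF \<open>4 \<le> d\<close>] by blast
  have "c * (1 / 4) powr \<bar>C\<bar> > 0" using \<open>c > 0\<close> by simp
  note small = eventually_share_bound[OF this, of d]
  show ?case
  proof
    assume "\<forall>\<^sub>F (R, Q) in (large_spaces d :: 'a qspace filter).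
      \<forall>P T r K. P \<subseteq> carrier (coord_space R d) \<and>
        r \<in> carrier R \<and> r \<noteq> \<zero>\<^bsub>R\<^esub> \<and> T \<subseteq> carrier (coord_space R d) \<times> {r} \<and>
        K > 0 \<and> K = surplus_constant R d Q P T \<and>
        fixed_scale_surplus R d Q K P T \<and> moderate_window R d C1 K P T \<longrightarrow>
        (\<exists>H\<in>hyperplanes R d. real (card (P \<inter> H)) \<ge> c * K powr (- C) * real (card P))"
    \<comment> \<open>For large \<open>q\<close> the chosen system is an admissible instance of the
      assumed bound, yet all its hyperplane shares are below \<open>c K^(-C)\<close>. Nontriviality
      of the filter turns this eventual contradiction into an actual one.\<close>
    with small good have "\<forall>\<^sub>F x in (large_spaces d :: 'a qspace filter). False"
    proof eventually_elim
      case (elim x)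
      obtain R Q where x: "x = (R, Q)" by (cases x)
      define B where "B = sys R Q"
      define P where "P = block_points R (coord_space R d) Q B"
      define T where "T = block_spheres R (coord_space R d) B"
      define K where "K = surplus_constant R d Q P T"
      have g: "good_system d R Q B" and s: "share_bound (order R) < c * (1 / 4) powr \<bar>C\<bar>"
        using elim by (auto simp: x B_def)
      have "P \<subseteq> carrier (coord_space R d)" "rad B \<in> carrier R" "rad B \<noteq> \<zero>\<^bsub>R\<^esub>"
        "T \<subseteq> carrier (coord_space R d) \<times> {rad B}" "K > 0" "fixed_scale_surplus R d Q K P T"
        using g by (auto simp: good_system_def block_system_def Let_def P_def T_def K_def)
      moreover have "moderate_window R d C1 K P T"
        unfolding K_def P_def T_def by (rule good_system_window(2)[OF g \<open>1 \<le> C1\<close>])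
      ultimately have "\<exists>H\<in>hyperplanes R d. real (card (P \<inter> H)) \<ge> c * K powr (- C) * real (card P)"
        using elim(3) K_def unfolding x by blast
      then obtain H where H: "H \<in> hyperplanes R d" "real (card (P \<inter> H)) \<ge> c * K powr (- C) * real (card P)"
        by blast
      then show ?case
        using good_system_small_share[OF g \<open>c > 0\<close> s H(1)] by (simp add: P_def T_def K_def)
    qed
    then show False
      by (simp add: eventually_False large_spaces_nontrivial)
  qed
next
  case (3 t C1)
  have t: "t > 0" "3 \<le> t" using 3 by auto
  \<comment> \<open>\<open>C1 K\<close> tends to \<open>C1 sqrt 2\<close>, and the hypothesis on
    \<open>C1\<close> says exactly that this limit exceeds \<open>t\<close>; the upper edge of the
    window follows for large \<open>q\<close>.\<close>
  have "((\<lambda>n. C1 * ((1 - 1 / real n) * sqrt 2)) \<longlongrightarrow> C1 * ((1 - 0) * sqrt 2)) at_top"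
    by (intro tendsto_intros lim_1_over_n)
  moreover have "real t < C1 * ((1 - 0) * sqrt 2)"
    using 3(2) by (simp add: field_simps)
  ultimately have "\<forall>\<^sub>F n in at_top. real t < C1 * ((1 - 1 / real n) * sqrt 2)"
    by (rule order_tendstoD(1))
  moreover have "\<forall>\<^sub>F n in at_top. max t 6 \<le> n"
    by (rule eventually_ge_at_top)
  ultimately have "\<forall>\<^sub>F n in at_top. real t < C1 * ((1 - 1 / real n) * sqrt 2) \<and> t \<le> n \<and> 6 \<le> n"
    by eventually_elim auto
  from eventually_order_large_spaces[OF this, of 3] eventually_nondeg_spaces[of 3]
  show ?case
  proof eventually_elim
    case (elim x)
    obtain R Q where x: "x = (R, Q)" by (cases x)
    let ?q = "real (order R)"
    have RQ: "(R, Q) \<in> nondeg_spaces 3" and tq: "t \<le> order R" and q6: "?q \<ge> 6"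
      and C1: "real t < C1 * ((1 - 1 / ?q) * sqrt 2)"
      using elim by (auto simp: x)
    obtain B where B: "block_system R (coord_space R 3) Q B"
      "exact_centered_blocks R (coord_space R 3) Q B" "card (idx B) = t"
      "card (block_spheres R (coord_space R 3) B) = t * order R"
      "surplus_constant R 3 Q (block_points R (coord_space R 3) Q B) (block_spheres R (coord_space R 3) B) =
        (1 - 1 / ?q) * sqrt 2"
      "\<And>z. z \<in> idx B \<Longrightarrow> discrepancy R (coord_space R 3) Q (point_block R (coord_space R 3) Q B z)
          (sphere_block R (coord_space R 3) B z) =
        discrepancy R (coord_space R 3) Q (block_points R (coord_space R 3) Q B)
          (block_spheres R (coord_space R 3) B) / real t"
      using exists_ternary_system[OF RQ t(1) tq] by blast
    \<comment> \<open>From \<open>q \<ge> 6\<close> the square of \<open>K\<close> is at least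
      \<open>25/18\<close>, hence at least \<open>4/3\<close>, and the lower edge is at most
      \<open>3 q\<close>. Since the square of \<open>K\<close> is always below 2, the lower edge
      exceeds \<open>2 q\<close>, so two blocks would not suffice.\<close>
    have "5 / 6 \<le> 1 - 1 / ?q" using q6 by (simp add: field_simps)
    then have "(5 / 6)\<^sup>2 \<le> (1 - 1 / ?q)\<^sup>2" by (intro power_mono) auto
    moreover have "(5 / 6 :: real)\<^sup>2 = 25 / 36" by (simp add: power2_eq_square)
    moreover have "((1 - 1 / ?q) * sqrt 2)\<^sup>2 = 2 * (1 - 1 / ?q)\<^sup>2" by (simp add: power_mult_distrib)
    ultimately have K2: "4 / 3 \<le> ((1 - 1 / ?q) * sqrt 2)\<^sup>2" by linarith
    have "4 * ?q / ((1 - 1 / ?q) * sqrt 2)\<^sup>2 \<le> 4 * ?q / (4 / 3)"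
      using K2 q6 by (intro divide_left_mono) auto
    also have "\<dots> = 3 * ?q" by simp
    also have "\<dots> \<le> real t * ?q"
      using t q6 by (intro mult_right_mono) auto
    finally have low: "4 * ?q / ((1 - 1 / ?q) * sqrt 2)\<^sup>2 \<le> real t * ?q" .
    have high: "real t * ?q \<le> C1 * ((1 - 1 / ?q) * sqrt 2) * ?q"
      using C1 q6 by (intro mult_right_mono) auto
    show ?case
      unfolding x prod.case Let_def
    proof (intro exI[of _ B] conjI, goal_cases)
      case 4
      then show ?case unfolding B(4,5) using low by simp
    next
      case 6
      then show ?case unfolding B(4,5) using high by simp
    next
      case 9
      then show ?case using B(2) by (auto simp: exact_centered_blocks_def)
    qed (use B in auto)
  qed
qed

end
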